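(* Let $f(z)=z+\sum_{n=2}^{\infty}a_nz^n\in\mathcal{C}_2$. Then $$|f(z)|+|f'(z)||z|+\sum_{n=2}^{\infty}|a_nz^n|\le d(f(0),\partial f(\mathbb{D}))$$ for $|z|\le r_{21}\simeq 0.173417$, where $r_{21}$ is the solution in $(0,1)$ of $$1-6r+r^2+2r^3=0.$$ The result is sharp, i.e. $r_{21}$ cannot be replaced by any larger number such that the inequality still holds for all $f\in\mathcal{C}_2$.
   Context: $\mathbb{D}=\{z\in\mathbb{C}:|z|<1\}$; $d$ is the Euclidean distance and $\partial f(\mathbb{D})$ is the boundary of $f(\mathbb{D})$. A convex function is a univalent analytic function on $\mathbb{D}$ whose image is a convex domain. The class $\mathcal{C}_2$ consists of the analytic functions $f(z)=z+\sum_{n=2}^\infty a_nz^n$ on $\mathbb{D}$ for which there exists a convex function $g(z)=b_1z+\cdots$ with $\operatorname{Re}(b_1)>0$ such that $\operatorname{Re}\left(\frac{(zf'(z))'}{g'(z)}\right)>0$ for all $z\in\mathbb{D}$. *)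

theory Defs
  imports "HOL-Complex_Analysis.Complex_Analysis"
begin

abbreviation unit_disk :: "complex set"
  where "unit_disk \<equiv> ball 0 1"

definition convex_function :: "(complex \<Rightarrow> complex) \<Rightarrow> bool"
  where "convex_function g \<longleftrightarrow>
    g holomorphic_on unit_disk \<and> inj_on g unit_disk \<and> convex (g ` unit_disk)"

(* The normalisations f(z) = z + a_2 z^2 + ... and g(z) = b_1 z + ... are expressed by the
   values of the functions and of their first derivatives at 0; in particular b_1 = g'(0). *)
definition class_C2 :: "(complex \<Rightarrow> complex) set"
  where "class_C2 = {f. f holomorphic_on unit_disk \<and> f 0 = 0 \<and> deriv f 0 = 1 \<and>
    (\<exists>g. convex_function g \<and> g 0 = 0 \<and> Re (deriv g 0) > 0 \<and>
      (\<forall>z\<in>unit_disk. Re (deriv (\<lambda>w. w * deriv f w) z / deriv g z) > 0))}"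

definition taylor_coeff :: "(complex \<Rightarrow> complex) \<Rightarrow> nat \<Rightarrow> complex"
  where "taylor_coeff f n = fps_nth (fps_expansion f 0) n"

(* infdist to an empty frontier is 0 rather than infinity. For z \<noteq> 0 near 0 the inequality
   then fails, so asserting it for f includes that f does not map the disk onto the plane. *)
definition bohr_inequality :: "(complex \<Rightarrow> complex) \<Rightarrow> complex \<Rightarrow> bool"
  where "bohr_inequality f z \<longleftrightarrow>
    norm (f z) + norm (deriv f z) * norm z + (\<Sum>n. norm (taylor_coeff f (n + 2) * z ^ (n + 2)))
      \<le> infdist (f 0) (frontier (f ` unit_disk))"

definition is_r21 :: "real \<Rightarrow> bool"
  where "is_r21 r \<longleftrightarrow> 0 < r \<and> r < 1 \<and> 1 - 6 * r + r ^ 2 + 2 * r ^ 3 = 0"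

definition r21 :: real
  where "r21 = (THE r. is_r21 r)"

end

theory Submission
  imports Defs
begin

text \<open>If f belongs to the class with associated convex function g, then h(z) = z f'(z) is close-to-convex
  with respect to g. Convex functions satisfy |b_n| \<le> |b_1| and functions of positive real part
  |p_n| \<le> 2 Re p_0, both by subordination, so h' = g' p gives |h_n| \<le> n and |a_n| \<le> 1; this bounds the
  left-hand side by the value attained by the half-plane map z / (1 - z).

  For the distance to the boundary, linear invariance of the close-to-convex class turns the bound for
  the second coefficient into |h'| \<ge> (1 - r) / (1 + r)^3. Since h and f are univalent, integrating
  along preimages of radial segments yields |h| \<ge> r / (1 + r)^2, that is |f'| \<ge> 1 / (1 + r)^2, and then
  |f| \<ge> r / (1 + r). Univalence of f also shows, by Liouville, that its image is not the whole plane.\<close>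

subsection \<open>Subordination and coefficient bounds\<close>

text \<open>A lower bound on a derivative bounds the modulus of the function from below only under
  univalence, so both integrations depend on it, and the univalence of f is the harder one. For h it
  suffices to compare differences h a - h b with g a - g b along a segment of the convex image of g.
  For f, the same comparison with b = 0 yields only Re (z f' / g) > 0. Repeating the chord argument
  for f would call for the function G with z G' = g as comparison function, and for its convexity.
  The proof instead uses that g, being convex, is starlike, and deforms f through f + t g. The
  constant 1/2 in the distance bound is the limit of r / (1 + r) as r tends to 1; it is also the
  distance from 0 to the line Re w = -1/2 that bounds the image of z / (1 - z).\<close>

lemma taylor_coeff_eqI: "f has_fps_expansion F \<Longrightarrow> taylor_coeff f n = fps_nth F n"
  unfolding taylor_coeff_def by (simp add: fps_expansion_eqI)

lemma taylor_coeff_0 [simp]: "taylor_coeff f 0 = f 0"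
  and taylor_coeff_1 [simp]: "taylor_coeff f (Suc 0) = deriv f 0"
  by (simp_all add: taylor_coeff_def fps_expansion_def)

lemma sums_taylor:
  assumes "f holomorphic_on unit_disk" "norm z < 1"
  shows "(\<lambda>n. taylor_coeff f n * z ^ n) sums f z"
  using holomorphic_power_series[of f 0 1 z] assms
  by (simp add: taylor_coeff_def fps_expansion_def)

text \<open>Schwarz's lemma for the self-map \<open>s\<close> of the disk obtained by following
  \<open>f\<close> with the inverse of \<open>F\<close>. The derivative bound serves the coefficient
  estimates, the pointwise bound the starlikeness of convex functions.\<close>

lemma subordinate_norm_le:
  assumes F: "F holomorphic_on unit_disk" "inj_on F unit_disk"
    and f: "f holomorphic_on unit_disk" "f 0 = F 0" "f ` unit_disk \<subseteq> F ` unit_disk"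
  shows "norm (deriv f 0) \<le> norm (deriv F 0)"
    and "\<And>z. norm z < 1 \<Longrightarrow> norm (inv_into unit_disk F (f z)) \<le> norm z"
proof -
  obtain k where k: "k holomorphic_on F ` unit_disk"
      "\<And>z. z \<in> unit_disk \<Longrightarrow> deriv F z * deriv k (F z) = 1"
      "\<And>z. z \<in> unit_disk \<Longrightarrow> k (F z) = z"
    using holomorphic_has_inverse[OF F(1) _ F(2)] by auto
  have opF: "open (F ` unit_disk)"
    by (rule open_mapping_thm3) (use F in auto)
  define s where "s = k \<circ> f"
  have s: "s holomorphic_on unit_disk"
    unfolding s_def by (rule holomorphic_on_compose_gen[OF f(1) k(1)]) (use f in auto)
  have s1: "norm (s z) < 1" if "norm z < 1" for z
  proof -
    from f(3) that obtain y where "y \<in> unit_disk" "f z = F y" by fastforce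
    then show ?thesis using k(3)[of y] by (simp add: s_def)
  qed
  have s0: "s 0 = 0" using k(3)[of 0] f(2) by (simp add: s_def)
  have inv_eq: "inv_into unit_disk F (f z) = s z" if "norm z < 1" for z
  proof -
    from f(3) that obtain y where "y \<in> unit_disk" "f z = F y" by fastforce
    then show ?thesis using k(3)[of y] F(2) by (simp add: s_def inv_into_f_f)
  qed
  show "norm (inv_into unit_disk F (f z)) \<le> norm z" if "norm z < 1" for z
    using Schwarz_Lemma(1)[OF s s0 s1 that] inv_eq[OF that] by simp
  have "deriv s 0 = deriv k (F 0) * deriv f 0"
    unfolding s_def using deriv_chain[of f 0 k] f(1,2) k(1) opF
    by (simp add: holomorphic_on_imp_differentiable_at)
  with k(2)[of 0] have "deriv f 0 = deriv F 0 * deriv s 0"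
    by (auto simp: field_simps)
  moreover have "norm (deriv s 0) \<le> 1"
    using Schwarz_Lemma(2)[OF s s0 s1, of 0] by simp
  ultimately show "norm (deriv f 0) \<le> norm (deriv F 0)"
    by (simp add: norm_mult mult_left_le)
qed

text \<open>The m-th powers of the n-th roots of unity add up to n or 0 according to whether n
  divides m, so averaging keeps only the exponents n * k. Writing the result in powers of
  \<open>w ^ n\<close> turns the n-th coefficient into a first coefficient.\<close>

lemma sums_root_of_unity_average:
  fixes n :: nat
  assumes f: "f holomorphic_on unit_disk" and w: "norm w < 1" and n: "n > 0"
  shows "(\<lambda>k. taylor_coeff f (n * k) * (w ^ n) ^ k) sums
           (\<Sum>j<n. (1 / real n) *\<^sub>R f (exp (2 * of_real pi * \<i> / of_nat n) ^ j * w))"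
proof -
  define u :: complex where "u = exp (2 * of_real pi * \<i> / of_nat n)"
  have um: "u ^ m = exp (2 * of_real pi * \<i> * of_nat m / of_nat n)" for m
    unfolding u_def by (simp add: exp_of_nat_mult [symmetric] field_simps)
  have nu: "norm u = 1" unfolding u_def by (simp add: norm_exp_eq_Re)
  have root_sum: "(\<Sum>j<n. (u ^ j) ^ m) = (if n dvd m then of_nat n else 0)" for m
  proof -
    have eq: "(\<Sum>j<n. (u ^ j) ^ m) = (\<Sum>j<n. (u ^ m) ^ j)"
      by (simp add: power_mult [symmetric] mult.commute)
    have iff: "u ^ m = 1 \<longleftrightarrow> n dvd m"
      unfolding um using complex_root_unity_eq_1[of n m] n by simp
    have "u ^ n = 1" using um[of n] n by simp
    then have "(u ^ m) ^ n = 1"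
      by (metis power_mult mult.commute power_one)
    then show ?thesis unfolding eq
      by (cases "n dvd m") (use iff geometric_sum[of "u ^ m" n] in auto)
  qed
  have "(\<lambda>m. \<Sum>j<n. (1 / real n) *\<^sub>R (taylor_coeff f m * (u ^ j * w) ^ m)) sums
      (\<Sum>j<n. (1 / real n) *\<^sub>R f (u ^ j * w))"
    by (intro sums_sum sums_scaleR_right sums_taylor f) (use w nu in \<open>simp add: norm_mult norm_power\<close>)
  also have "(\<lambda>m. \<Sum>j<n. (1 / real n) *\<^sub>R (taylor_coeff f m * (u ^ j * w) ^ m)) =
      (\<lambda>m. if n dvd m then taylor_coeff f m * w ^ m else 0)"
  proof
    fix m
    have "(\<Sum>j<n. (1 / real n) *\<^sub>R (taylor_coeff f m * (u ^ j * w) ^ m)) =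
        (1 / real n) *\<^sub>R (taylor_coeff f m * w ^ m * (\<Sum>j<n. (u ^ j) ^ m))"
      by (simp add: scaleR_right.sum [symmetric] sum_distrib_left power_mult_distrib mult_ac)
    then show "(\<Sum>j<n. (1 / real n) *\<^sub>R (taylor_coeff f m * (u ^ j * w) ^ m)) =
        (if n dvd m then taylor_coeff f m * w ^ m else 0)"
      using n by (simp add: root_sum scaleR_conv_of_real)
  qed
  finally have "(\<lambda>m. if n dvd m then taylor_coeff f m * w ^ m else 0) sums
      (\<Sum>j<n. (1 / real n) *\<^sub>R f (u ^ j * w))" .
  then have "(\<lambda>k. if n dvd n * k then taylor_coeff f (n * k) * w ^ (n * k) else 0) sums
      (\<Sum>j<n. (1 / real n) *\<^sub>R f (u ^ j * w))"
    using sums_mono_reindex[of "(*) n" "\<lambda>m. if n dvd m then taylor_coeff f m * w ^ m else 0"] n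
    by (simp add: strict_mono_def image_iff dvd_def)
  then show ?thesis by (simp add: power_mult u_def)
qed

text \<open>The average of f over the rotations by n-th roots of unity is a function of z ^ n. By convexity this
  function is again subordinate to F, and its first coefficient is the n-th coefficient of f.\<close>
theorem rogosinski_convex:
  assumes F: "F holomorphic_on unit_disk" "inj_on F unit_disk" "convex (F ` unit_disk)"
    and f: "f holomorphic_on unit_disk" "f 0 = F 0" "f ` unit_disk \<subseteq> F ` unit_disk"
    and n: "n > 0"
  shows "norm (taylor_coeff f n) \<le> norm (deriv F 0)"
proof -
  define P where "P = (\<lambda>z. \<Sum>k. taylor_coeff f (n * k) * z ^ k)"
  have P: "(\<lambda>k. taylor_coeff f (n * k) * z ^ k) sums P z \<and> P z \<in> F ` unit_disk"
    if z: "norm z < 1" for z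
  proof -
    \<comment> \<open>Any root will do, with no holomorphic choice: \<open>P\<close> is defined by
      its power series, and the root only serves to locate its value in the convex image.\<close>
    obtain w where w: "w ^ n = z"
      using n by (metis exists_complex_root neq0_conv)
    with z have w1: "norm w < 1"
      by (metis n norm_ge_zero norm_power not_less one_le_power)
    let ?u = "exp (2 * of_real pi * \<i> / of_nat n) :: complex"
    let ?S = "\<Sum>j<n. (1 / real n) *\<^sub>R f (?u ^ j * w)"
    have sums: "(\<lambda>k. taylor_coeff f (n * k) * z ^ k) sums ?S"
      using sums_root_of_unity_average[OF f(1) w1 n] by (simp add: w)
    moreover have "?S \<in> F ` unit_disk"
    proof (rule convex_sum[OF _ F(3)])
      fix j
      have "?u ^ j * w \<in> unit_disk"
        using w1 by (simp add: norm_mult norm_power norm_exp_eq_Re)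
      then show "f (?u ^ j * w) \<in> F ` unit_disk" using f(3) by blast
    qed (use n in auto)
    ultimately show ?thesis by (simp add: P_def sums_iff)
  qed
  have hol: "P holomorphic_on unit_disk"
    by (rule power_series_holomorphic[where a = "\<lambda>k. taylor_coeff f (n * k)"]) (use P in simp)
  have exp: "P has_fps_expansion Abs_fps (\<lambda>k. taylor_coeff f (n * k))"
  proof (rule has_fps_expansionI)
    have "eventually (\<lambda>u. u \<in> unit_disk) (nhds (0::complex))"
      by (intro eventually_nhds_in_open) auto
    then show "\<forall>\<^sub>F u in nhds 0. (\<lambda>k. fps_nth (Abs_fps (\<lambda>k. taylor_coeff f (n * k))) k * u ^ k) sums P u"
      by eventually_elim (use P in simp)
  qed
  have "P 0 = F 0" using taylor_coeff_eqI[OF exp, of 0] f(2) by simp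
  moreover have "deriv P 0 = taylor_coeff f n"
    using taylor_coeff_eqI[OF exp, of 1] by simp
  moreover have "P ` unit_disk \<subseteq> F ` unit_disk" using P by auto
  ultimately show ?thesis using subordinate_norm_le(1)[OF F(1,2) hol] by simp
qed

text \<open>The Moebius map of the disk onto the right half-plane with F 0 = c; solving F z = w
  gives the inverse (w - c) / (w + cnj c). A general c avoids normalising functions of positive real
  part at 0.\<close>

lemma halfplane_map:
  fixes c :: complex
  assumes c: "Re c > 0"
  defines "F \<equiv> \<lambda>z. (c + cnj c * z) / (1 - z)"
  shows "F holomorphic_on unit_disk" "inj_on F unit_disk" "F ` unit_disk = {w. Re w > 0}"
    and "norm (deriv F 0) = 2 * Re c"
proof -
  have nz: "1 - z \<noteq> 0" if "norm z < 1" for z :: complex using that by auto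
  show "F holomorphic_on unit_disk"
    unfolding F_def by (intro holomorphic_intros) auto
  have cc: "c + cnj c \<noteq> 0" "cnj c + c \<noteq> 0"
    using c by (auto simp: complex_eq_iff)
  show "inj_on F unit_disk"
  proof (rule inj_onI)
    fix x y assume x: "x \<in> unit_disk" and y: "y \<in> unit_disk" and eq: "F x = F y"
    have "(c + cnj c * x) * (1 - y) = (c + cnj c * y) * (1 - x)"
      using eq nz[of x] nz[of y] x y unfolding F_def by (simp add: field_simps)
    then have "(c + cnj c) * (x - y) = 0" by (simp add: algebra_simps)
    with cc show "x = y" by simp
  qed
  have pos: "Re (F z) > 0" if z: "norm z < 1" for z
  proof -
    have eq: "F z = ((c + cnj c * z) * cnj (1 - z)) / of_real ((norm (1 - z))\<^sup>2)"
      unfolding F_def by (subst complex_div_cnj) simp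
    have "Re ((c + cnj c * z) * cnj (1 - z)) = Re c * (1 - (norm z)\<^sup>2)"
      by (simp add: cmod_power2 algebra_simps) (simp add: power2_eq_square algebra_simps)
    moreover have "(norm z)\<^sup>2 < 1" using z by (simp add: abs_square_less_1)
    ultimately show ?thesis
      unfolding eq Re_divide_of_real using c nz[OF z] by simp
  qed
  show "F ` unit_disk = {w. Re w > 0}"
  proof
    show "F ` unit_disk \<subseteq> {w. Re w > 0}" using pos by auto
    show "{w. Re w > 0} \<subseteq> F ` unit_disk"
    proof
      fix w assume "w \<in> {w. Re w > 0}"
      then have w: "Re w > 0" by simp
      define z where "z = (w - c) / (w + cnj c)"
      have d: "w + cnj c \<noteq> 0" using w c by (auto simp: complex_eq_iff)
      \<comment> \<open>A point of the right half-plane is closer to c than to the mirror image -cnj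
        c; the squares differ by 4 Re w Re c.\<close>
      have "(norm (w - c))\<^sup>2 < (norm (w + cnj c))\<^sup>2"
        using mult_pos_pos[OF w c] by (simp add: cmod_power2) (simp add: power2_eq_square algebra_simps)
      then have "norm (w - c) < norm (w + cnj c)" by (rule power2_less_imp_less) simp
      then have z: "norm z < 1" using d by (simp add: z_def norm_divide)
      have "1 - z = (c + cnj c) / (w + cnj c)" "c + cnj c * z = w * (c + cnj c) / (w + cnj c)"
        using d by (simp_all add: z_def field_simps)
      then have "F z = w" unfolding F_def using d cc by simp
      then show "w \<in> F ` unit_disk" using z by force
    qed
  qed
  have "(F has_field_derivative (cnj c + c)) (at 0)"
    unfolding F_def by (auto intro!: derivative_eq_intros)
  then have "deriv F 0 = of_real (2 * Re c)"
    by (simp add: DERIV_imp_deriv complex_add_cnj add.commute)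
  then show "norm (deriv F 0) = 2 * Re c" using c by (simp only: norm_of_real)
qed

text \<open>\<open>p\<close> is subordinate to the half-plane map with c = p 0, whose image is
  convex and whose derivative at 0 has modulus 2 Re c.\<close>

theorem caratheodory_coeff:
  assumes p: "p holomorphic_on unit_disk" "\<And>z. norm z < 1 \<Longrightarrow> Re (p z) > 0" and n: "n > 0"
  shows "norm (taylor_coeff p n) \<le> 2 * Re (p 0)"
proof -
  have c: "Re (p 0) > 0" using p by simp
  note F = halfplane_map[OF c]
  show ?thesis
    by (rule order_trans[OF rogosinski_convex[OF F(1,2) _ p(1) _ _ n]])
       (use F p in \<open>auto simp: convex_halfspace_Re_gt\<close>)
qed

text \<open>A convex function is subordinate to itself.\<close>

lemma taylor_coeff_convex_function:
  assumes "convex_function g" "n > 0"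
  shows "norm (taylor_coeff g n) \<le> norm (deriv g 0)"
  by (rule rogosinski_convex) (use assms in \<open>auto simp: convex_function_def\<close>)

lemma convex_function_deriv_nonzero:
  "convex_function g \<Longrightarrow> norm z < 1 \<Longrightarrow> deriv g z \<noteq> 0"
  unfolding convex_function_def by (intro holomorphic_injective_imp_regular[of _ unit_disk]) auto

text \<open>Comparing coefficients in h' = g' p writes n h_n as a Cauchy product. Neither h nor g is
  normalised, so that the bound can be applied after composition with an automorphism of the
  disk.\<close>

theorem taylor_coeff_close_to_convex:
  assumes h: "h holomorphic_on unit_disk" and g: "convex_function g"
    and pos: "\<And>z. norm z < 1 \<Longrightarrow> Re (deriv h z / deriv g z) > 0" and n: "n > 0"
  shows "norm (taylor_coeff h n) \<le> real n * norm (deriv h 0)"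
proof -
  define p where "p = (\<lambda>z. deriv h z / deriv g z)"
  have hg: "g holomorphic_on unit_disk" using g by (simp add: convex_function_def)
  have p: "p holomorphic_on unit_disk"
    unfolding p_def
    by (intro holomorphic_intros h hg holomorphic_deriv convex_function_deriv_nonzero[OF g]) auto
  note exps = has_fps_expansion_fps_expansion[of unit_disk]
  have "(\<lambda>z. deriv g z * p z) has_fps_expansion
      fps_deriv (fps_expansion g 0) * fps_expansion p 0"
    by (intro fps_expansion_intros exps) (use hg p in auto)
  moreover have "deriv h has_fps_expansion fps_deriv (fps_expansion h 0)"
    by (intro fps_expansion_intros exps) (use h in auto)
  moreover have "\<forall>\<^sub>F z in nhds 0. deriv g z * p z = deriv h z"
  proof -
    have "eventually (\<lambda>u. u \<in> unit_disk) (nhds (0::complex))"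
      by (intro eventually_nhds_in_open) auto
    then show ?thesis
      by eventually_elim (simp add: p_def convex_function_deriv_nonzero[OF g])
  qed
  ultimately have eq: "fps_deriv (fps_expansion h 0) = fps_deriv (fps_expansion g 0) * fps_expansion p 0"
    by (metis fps_expansion_unique_complex has_fps_expansion_cong)
  obtain m where m: "n = Suc m" using n by (cases n) auto
  have "of_nat n * taylor_coeff h n =
      (\<Sum>k=0..m. of_nat (Suc k) * taylor_coeff g (Suc k) * taylor_coeff p (m - k))"
    using arg_cong[OF eq, of "\<lambda>F. fps_nth F m"]
    by (simp add: m taylor_coeff_def fps_mult_nth del: of_nat_Suc)
  then have "real n * norm (taylor_coeff h n) =
      norm (\<Sum>k=0..m. of_nat (Suc k) * taylor_coeff g (Suc k) * taylor_coeff p (m - k))"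
    by (metis norm_mult norm_of_nat)
  also have "\<dots> \<le> (\<Sum>k=0..m. real (Suc k) * norm (deriv g 0) * ((if k = m then 1 else 2) * norm (p 0)))"
  proof (rule sum_norm_le)
    fix k assume k: "k \<in> {0..m}"
    \<comment> \<open>The factor 2 belongs to coefficients of positive index; for k = m the
      coefficient is p 0 itself.\<close>
    have "norm (taylor_coeff p (m - k)) \<le> (if k = m then 1 else 2) * norm (p 0)"
      using caratheodory_coeff[OF p, of "m - k"] pos k complex_Re_le_cmod[of "p 0"]
      by (auto simp: p_def)
    then show "norm (of_nat (Suc k) * taylor_coeff g (Suc k) * taylor_coeff p (m - k)) \<le>
        real (Suc k) * norm (deriv g 0) * ((if k = m then 1 else 2) * norm (p 0))"
      unfolding norm_mult norm_of_nat
      by (intro mult_mono taylor_coeff_convex_function[OF g]) auto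
  qed
  also have "\<dots> = norm (deriv g 0) * norm (p 0) * (\<Sum>k=0..m. real (Suc k) * (if k = m then 1 else 2))"
    by (simp add: sum_distrib_left mult_ac)
  \<comment> \<open>With n = m + 1, the terms below m give m (m + 1) and the last one m + 1. One
    factor n then cancels against the n produced by differentiating h.\<close>
  also have "(\<Sum>k=0..m. real (Suc k) * (if k = m then 1 else 2)) = real n ^ 2"
  proof -
    have "(\<Sum>k<j. real (Suc k) * 2) = real j * (real j + 1)" for j
      by (induction j) (simp_all add: algebra_simps)
    moreover have "(\<Sum>k=0..m. real (Suc k) * (if k = m then 1 else 2)) = (\<Sum>k<m. real (Suc k) * 2) + real (Suc m)"
      by (simp add: atLeast0AtMost lessThan_Suc_atMost [symmetric])
    ultimately show ?thesis by (simp add: m power2_eq_square algebra_simps)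
  qed
  also have "norm (deriv g 0) * norm (p 0) = norm (deriv h 0)"
    using convex_function_deriv_nonzero[OF g, of 0] by (simp add: p_def norm_divide)
  finally have "real n * norm (taylor_coeff h n) \<le> real n * (real n * norm (deriv h 0))"
    by (simp add: power2_eq_square mult_ac)
  then show ?thesis using n by simp
qed


subsection \<open>Distortion and growth\<close>

text \<open>The hypotheses are invariant under automorphisms of the disk. Moving a to 0 turns the claim into
  the bound for the second Taylor coefficient.\<close>
lemma deriv_close_to_convex_second:
  assumes h: "h holomorphic_on unit_disk" and g: "convex_function g"
    and pos: "\<And>z. norm z < 1 \<Longrightarrow> Re (deriv h z / deriv g z) > 0" and a: "norm a < 1"
  shows "norm (deriv (deriv h) a * (1 - (norm a)\<^sup>2) - 2 * cnj a * deriv h a) \<le> 4 * norm (deriv h a)"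
proof -
  \<comment> \<open>This is (z + a) / (1 + cnj a * z), which sends 0 to a; its inverse is
    \<open>Moebius_function 0 a\<close>.\<close>
  define \<phi> where "\<phi> = Moebius_function 0 (-a)"
  have hg: "g holomorphic_on unit_disk" using g by (simp add: convex_function_def)
  have \<phi>: "\<phi> holomorphic_on unit_disk"
    unfolding \<phi>_def by (rule Moebius_function_holomorphic) (use a in simp)
  have maps: "norm (\<phi> z) < 1" if "norm z < 1" for z
    unfolding \<phi>_def by (rule Moebius_function_norm_lt_1) (use a that in auto)
  have inv1: "\<phi> (Moebius_function 0 a z) = z" "Moebius_function 0 a (\<phi> z) = z" if "norm z < 1" for z
    unfolding \<phi>_def using a that by (auto intro!: Moebius_function_compose)
  have maps': "norm (Moebius_function 0 a z) < 1" if "norm z < 1" for z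
    by (rule Moebius_function_norm_lt_1) (use a that in auto)
  have img: "\<phi> ` unit_disk = unit_disk"
  proof
    show "\<phi> ` unit_disk \<subseteq> unit_disk" using maps by auto
    show "unit_disk \<subseteq> \<phi> ` unit_disk"
    proof
      fix z assume "z \<in> unit_disk"
      then have "norm z < 1" by simp
      then show "z \<in> \<phi> ` unit_disk" using inv1(1) maps'
        by (intro image_eqI[of _ _ "Moebius_function 0 a z"]) simp_all
    qed
  qed
  have injphi: "inj_on \<phi> unit_disk"
    by (rule inj_on_inverseI[of _ "Moebius_function 0 a"]) (use inv1 in simp)
  have nz: "1 + cnj a * z \<noteq> 0" if "norm z < 1" for z
  proof -
    have "norm (cnj a * z) < 1"
      using norm_mult_less[of "cnj a" 1 z 1] a that by simp
    then show ?thesis by (auto simp: add_eq_0_iff)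
  qed
  have d\<phi>: "(\<phi> has_field_derivative (1 - (norm a)\<^sup>2) / (1 + cnj a * z)\<^sup>2) (at z)" if "norm z < 1" for z
  proof -
    have "(\<phi> has_field_derivative ((1 + cnj a * z) - (z + a) * cnj a) / ((1 + cnj a * z) * (1 + cnj a * z))) (at z)"
      unfolding \<phi>_def Moebius_function_def using nz[OF that]
      by (auto intro!: derivative_eq_intros)
    moreover have "(1 + cnj a * z) - (z + a) * cnj a = 1 - (norm a)\<^sup>2"
      using complex_norm_square[of a] by (simp add: algebra_simps)
    ultimately show ?thesis by (simp add: power2_eq_square)
  qed
  have fd: "f field_differentiable at z" if "f holomorphic_on unit_disk" "norm z < 1" for f z
    using that by (simp add: holomorphic_on_imp_differentiable_at)
  have chain: "deriv (f \<circ> \<phi>) z = deriv f (\<phi> z) * ((1 - (norm a)\<^sup>2) / (1 + cnj a * z)\<^sup>2)"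
    if "f holomorphic_on unit_disk" "norm z < 1" for f z
    using deriv_chain[of \<phi> z f] DERIV_imp_deriv[OF d\<phi>[OF that(2)]] fd[OF \<phi> that(2)]
      fd[OF that(1) maps[OF that(2)]] by simp
  have a1: "1 - complex_of_real ((norm a)\<^sup>2) \<noteq> 0"
  proof
    assume "1 - complex_of_real ((norm a)\<^sup>2) = 0"
    then have "complex_of_real ((norm a)\<^sup>2) = complex_of_real 1" by simp
    then show False using a by (simp only: of_real_eq_iff) (simp add: abs_square_eq_1)
  qed
  have hol: "h \<circ> \<phi> holomorphic_on unit_disk"
    by (rule holomorphic_on_compose_gen[OF \<phi> h]) (use img in simp)
  \<comment> \<open>Composition with an automorphism leaves the image of g, and hence its convexity,
    unchanged.\<close>
  have conv: "convex_function (g \<circ> \<phi>)"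
    unfolding convex_function_def
  proof (intro conjI)
    show "g \<circ> \<phi> holomorphic_on unit_disk"
      by (rule holomorphic_on_compose_gen[OF \<phi> hg]) (use img in simp)
    show "inj_on (g \<circ> \<phi>) unit_disk"
      using injphi img g by (auto intro!: comp_inj_on simp: convex_function_def)
    show "convex ((g \<circ> \<phi>) ` unit_disk)"
      using g by (simp only: image_comp [symmetric] img convex_function_def)
  qed
  \<comment> \<open>The derivative of \<open>\<phi>\<close> cancels in the quotient.\<close>
  have "Re (deriv (h \<circ> \<phi>) z / deriv (g \<circ> \<phi>) z) > 0" if z: "norm z < 1" for z
    using pos[OF maps[OF z]] nz[OF z] a1 by (simp add: chain[OF h z] chain[OF hg z])
  \<comment> \<open>The second coefficient is half the second derivative, so its bound 2 becomes the
    4 of the claim; a common factor 1 - |a|^2 is divided out at the end.\<close>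
  from taylor_coeff_close_to_convex[OF hol conv this, of 2]
  have "norm (taylor_coeff (h \<circ> \<phi>) 2) \<le> 2 * norm (deriv (h \<circ> \<phi>) 0)" by simp
  moreover have "taylor_coeff (h \<circ> \<phi>) 2 = deriv (deriv (h \<circ> \<phi>)) 0 / 2"
    by (simp add: taylor_coeff_def fps_expansion_def numeral_2_eq_2)
  moreover have "deriv (deriv (h \<circ> \<phi>)) 0 =
      (deriv (deriv h) a * (1 - (norm a)\<^sup>2) - 2 * cnj a * deriv h a) * (1 - (norm a)\<^sup>2)"
  proof -
    have "eventually (\<lambda>u. u \<in> unit_disk) (nhds (0::complex))"
      by (intro eventually_nhds_in_open) auto
    then have "\<forall>\<^sub>F z in nhds 0. deriv (h \<circ> \<phi>) z = deriv h (\<phi> z) * ((1 - (norm a)\<^sup>2) / (1 + cnj a * z)\<^sup>2)"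
      by eventually_elim (simp add: chain[OF h])
    then have eq: "deriv (deriv (h \<circ> \<phi>)) 0 = deriv (\<lambda>z. deriv h (\<phi> z) * ((1 - (norm a)\<^sup>2) / (1 + cnj a * z)\<^sup>2)) 0"
      by (rule deriv_cong_ev) simp
    have phi0: "\<phi> 0 = a" by (simp add: \<phi>_def Moebius_function_def)
    have dh: "(deriv h has_field_derivative deriv (deriv h) (\<phi> 0)) (at (\<phi> 0))"
      using fd[OF holomorphic_deriv[OF h], of a] a phi0 by (simp add: field_differentiable_derivI)
    have d0: "(\<phi> has_field_derivative (1 - (norm a)\<^sup>2)) (at 0)" using d\<phi>[of 0] by simp
    have "((\<lambda>z. deriv h (\<phi> z)) has_field_derivative deriv (deriv h) (\<phi> 0) * (1 - (norm a)\<^sup>2)) (at 0)"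
      by (rule DERIV_chain2[OF dh d0])
    moreover have "((\<lambda>z. (1 - (norm a)\<^sup>2) / (1 + cnj a * z)\<^sup>2) has_field_derivative
        - 2 * cnj a * (1 - (norm a)\<^sup>2)) (at 0)"
      by (auto intro!: derivative_eq_intros)
    ultimately have "((\<lambda>z. deriv h (\<phi> z) * ((1 - (norm a)\<^sup>2) / (1 + cnj a * z)\<^sup>2)) has_field_derivative
        deriv h (\<phi> 0) * (- 2 * cnj a * (1 - (norm a)\<^sup>2)) +
        deriv (deriv h) (\<phi> 0) * (1 - (norm a)\<^sup>2) * ((1 - (norm a)\<^sup>2) / (1 + cnj a * 0)\<^sup>2)) (at 0)"
      by (rule DERIV_mult')
    from DERIV_imp_deriv[OF this] eq phi0 show ?thesis by (simp add: algebra_simps power2_eq_square)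
  qed
  moreover have "deriv (h \<circ> \<phi>) 0 = deriv h a * (1 - (norm a)\<^sup>2)"
    using chain[OF h, of 0] by (simp add: \<phi>_def Moebius_function_def)
  ultimately have "norm (deriv (deriv h) a * (1 - (norm a)\<^sup>2) - 2 * cnj a * deriv h a) * norm (1 - complex_of_real ((norm a)\<^sup>2))
      \<le> 4 * norm (deriv h a) * norm (1 - complex_of_real ((norm a)\<^sup>2))"
    by (simp add: norm_mult norm_divide)
  then show ?thesis using a1 by simp
qed

text \<open>At radius q the second-coefficient bound puts the radial derivative of log |h'| above (2
  q - 4) / (1 - q^2) = -1 / (1 - q) - 3 / (1 + q), which is the logarithmic derivative of (1 - q) /
  (1 + q)^3.\<close>

theorem close_to_convex_deriv_lower:
  assumes h: "h holomorphic_on unit_disk" and g: "convex_function g"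
    and pos: "\<And>z. norm z < 1 \<Longrightarrow> Re (deriv h z / deriv g z) > 0" and z: "norm z < 1"
  shows "norm (deriv h z) \<ge> norm (deriv h 0) * ((1 - norm z) / (1 + norm z) ^ 3)"
proof -
  have dnz: "deriv h z \<noteq> 0" if "norm z < 1" for z
    using pos[OF that] by auto
  have hd: "deriv h holomorphic_on unit_disk" by (intro holomorphic_deriv h) auto
  have "contractible unit_disk" by (simp add: convex_imp_contractible)
  from contractible_imp_holomorphic_log[OF hd this] dnz
  obtain L where L: "L holomorphic_on unit_disk" "\<And>z. norm z < 1 \<Longrightarrow> deriv h z = exp (L z)"
    by (metis mem_ball_0)
  have dL: "deriv (deriv h) w = deriv h w * deriv L w" if w: "norm w < 1" for w
  proof -
    have "(L has_field_derivative deriv L w) (at w)"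
      using L(1) w by (auto intro!: holomorphic_derivI[of _ unit_disk])
    then have "((\<lambda>w. exp (L w)) has_field_derivative exp (L w) * deriv L w) (at w)"
      by (rule DERIV_fun_exp)
    moreover have "\<forall>\<^sub>F z in nhds w. deriv h z = exp (L z)"
      using eventually_nhds_in_open[of unit_disk w] w
      by (auto elim!: eventually_mono simp: L(2))
    ultimately show ?thesis
      using L(2)[OF w] by (metis DERIV_imp_deriv deriv_cong_ev)
  qed
  let ?r = "norm z"
  \<comment> \<open>With r = |z|, this is the logarithm of |h' (s z)| (1 + s r)^3 / (1 - s r), so
    the claim is that it does not fall between s = 0 and s = 1.\<close>
  define \<psi> where "\<psi> = (\<lambda>s. Re (L (of_real s * z)) - ln (1 - s * ?r) + 3 * ln (1 + s * ?r))"
  have "\<psi> 0 \<le> \<psi> 1"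
  proof (rule DERIV_nonneg_imp_nondecreasing[where f = \<psi>])
    fix s :: real assume s: "0 \<le> s" "s \<le> 1"
    let ?w = "of_real s * z"
    define q where "q = s * ?r"
    have q: "0 \<le> q" "q < 1" and nw: "norm ?w = q"
    proof -
      show "0 \<le> q" using s by (simp add: q_def)
      have "s * ?r \<le> 1 * ?r" using s by (intro mult_right_mono) auto
      then show "q < 1" using z by (simp add: q_def)
      show "norm ?w = q" using s by (simp add: q_def norm_mult)
    qed
    have w1: "norm ?w < 1" using nw q by simp
    have "norm (deriv h ?w * (deriv L ?w * (1 - complex_of_real (q\<^sup>2)) - 2 * cnj ?w)) \<le> 4 * norm (deriv h ?w)"
      using deriv_close_to_convex_second[OF h g pos w1] dL[OF w1] nw by (simp add: algebra_simps)
    then have b: "norm (deriv L ?w * (1 - complex_of_real (q\<^sup>2)) - 2 * cnj ?w) \<le> 4"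
      using dnz[OF w1] by (simp add: norm_mult)
    have q2: "1 - q\<^sup>2 > 0" using q by (simp add: abs_square_less_1)
    \<comment> \<open>Multiplication by z makes the conjugate term real, since z * cnj z = |z|^2,
      and turns the other one into the derivative of L along the ray.\<close>
    have eq: "(deriv L ?w * (1 - complex_of_real (q\<^sup>2)) - 2 * cnj ?w) * z =
        of_real (1 - q\<^sup>2) * (z * deriv L ?w) - of_real (2 * s * ?r\<^sup>2)"
      using complex_norm_square[of z] by (simp add: algebra_simps)
    have "norm (of_real (1 - q\<^sup>2) * (z * deriv L ?w) - of_real (2 * s * ?r\<^sup>2)) \<le> 4 * ?r"
      unfolding eq [symmetric] norm_mult by (intro mult_right_mono b) simp
    then have "Re (of_real (1 - q\<^sup>2) * (z * deriv L ?w) - of_real (2 * s * ?r\<^sup>2)) \<ge> - (4 * ?r)"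
      using abs_Re_le_cmod[of "of_real (1 - q\<^sup>2) * (z * deriv L ?w) - of_real (2 * s * ?r\<^sup>2)"] by linarith
    then have "(1 - q\<^sup>2) * Re (z * deriv L ?w) \<ge> 2 * q * ?r - 4 * ?r"
      by (simp only: minus_complex.sel Re_complex_of_real times_complex.sel(1)[of "of_real _"] Im_complex_of_real)
         (simp add: q_def power2_eq_square mult_ac)
    then have lower: "Re (z * deriv L ?w) \<ge> (2 * q * ?r - 4 * ?r) / (1 - q\<^sup>2)"
      using q2 by (simp add: field_simps)
    have dLs: "((\<lambda>s. L (of_real s * z)) has_vector_derivative z * deriv L ?w) (at s)"
    proof -
      have "(L has_field_derivative deriv L ?w) (at ?w)"
        using L(1) w1 by (auto intro!: holomorphic_derivI[of _ unit_disk])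
      moreover have "((\<lambda>s. of_real s * z) has_vector_derivative z) (at s)"
        by (auto intro!: derivative_eq_intros has_vector_derivative_real_field)
      ultimately show ?thesis
        using field_vector_diff_chain_at[of "\<lambda>s. of_real s * z" z s L] by (simp add: o_def)
    qed
    have dRe: "((\<lambda>s. Re (L (of_real s * z))) has_real_derivative Re (z * deriv L ?w)) (at s)"
      using bounded_linear.has_vector_derivative[OF bounded_linear_Re dLs] by (simp add: has_real_derivative_iff_has_vector_derivative)
    have "(\<psi> has_real_derivative Re (z * deriv L ?w) + ?r / (1 - q) + 3 * (?r / (1 + q))) (at s)"
    proof -
      have "((\<lambda>s. ln (1 - s * ?r)) has_real_derivative - (?r / (1 - q))) (at s)"
        using q by (auto intro!: derivative_eq_intros simp: q_def)
      moreover have "((\<lambda>s. 3 * ln (1 + s * ?r)) has_real_derivative 3 * (?r / (1 + q))) (at s)"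
        using q by (auto intro!: derivative_eq_intros simp: q_def)
      ultimately show ?thesis
        unfolding \<psi>_def using DERIV_add[OF DERIV_diff[OF dRe]] by fastforce
    qed
    moreover have "(2 * q * ?r - 4 * ?r) / (1 - q\<^sup>2) + ?r / (1 - q) + 3 * (?r / (1 + q)) = 0"
    proof -
      have "1 - q\<^sup>2 = (1 - q) * (1 + q)" by (simp add: power2_eq_square algebra_simps)
      moreover have "1 - q \<noteq> 0" "1 + q \<noteq> 0" using q by auto
      ultimately show ?thesis by (simp add: divide_simps) (simp add: algebra_simps)
    qed
    ultimately show "\<exists>y. (\<psi> has_real_derivative y) (at s) \<and> 0 \<le> y"
      using lower by (intro exI[of _ "Re (z * deriv L ?w) + ?r / (1 - q) + 3 * (?r / (1 + q))"]) auto
  qed simp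
  then have "Re (L 0) + ln (1 - ?r) - 3 * ln (1 + ?r) \<le> Re (L z)" by (simp add: \<psi>_def)
  then have "exp (Re (L 0) + ln (1 - ?r) - 3 * ln (1 + ?r)) \<le> norm (deriv h z)"
    using L(2)[OF z] by simp
  moreover have "exp (Re (L 0) + ln (1 - ?r) - 3 * ln (1 + ?r)) = norm (deriv h 0) * ((1 - ?r) / (1 + ?r) ^ 3)"
  proof -
    have "0 < 1 + ?r" by (simp add: add_pos_nonneg)
    then have "exp (3 * ln (1 + ?r)) = (1 + ?r) ^ 3"
      using exp_of_nat_mult[of 3 "ln (1 + ?r)"] by simp
    then show ?thesis using L(2)[of 0] z by (simp add: exp_add exp_diff)
  qed
  ultimately show ?thesis by simp
qed

text \<open>The derivative of the modulus is the inner product of the velocity with a unit vector,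
  so Cauchy-Schwarz bounds it by the speed.\<close>

lemma norm_along_path_derivative:
  fixes k :: "complex \<Rightarrow> complex" and s :: real
  assumes k: "(k has_field_derivative k') (at (of_real s * w))" and nz: "k (of_real s * w) \<noteq> 0"
  shows "\<exists>d. ((\<lambda>s. norm (k (of_real s * w))) has_real_derivative d) (at s) \<and> d \<le> norm (k' * w)"
proof -
  have "((\<lambda>s. k (of_real s * w)) has_vector_derivative w * k') (at s)"
  proof -
    have "((\<lambda>s. of_real s * w) has_vector_derivative w) (at s)"
      by (auto intro!: derivative_eq_intros has_vector_derivative_real_field)
    from field_vector_diff_chain_at[OF this, of k k'] k show ?thesis by (simp add: o_def)
  qed
  then have "((\<lambda>s. k (of_real s * w)) has_derivative (\<lambda>h. h *\<^sub>R (w * k'))) (at s)"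
    by (simp add: has_vector_derivative_def)
  from has_derivative_compose[OF this has_derivative_norm[OF nz]]
  have "((\<lambda>s. norm (k (of_real s * w))) has_derivative
      (\<lambda>h. h * inner (sgn (k (of_real s * w))) (w * k'))) (at s)"
    by (simp add: inner_commute)
  then have "((\<lambda>s. norm (k (of_real s * w))) has_real_derivative inner (sgn (k (of_real s * w))) (w * k')) (at s)"
    unfolding has_field_derivative_def by (rule has_derivative_eq_rhs) (simp add: fun_eq_iff)
  moreover have "inner (sgn (k (of_real s * w))) (w * k') \<le> norm (k' * w)"
    using norm_cauchy_schwarz[of "sgn (k (of_real s * w))" "w * k'"] nz
    by (simp add: norm_sgn mult.commute)
  ultimately show ?thesis by blast
qed

text \<open>The segment from 0 to the point of the image of the circle of radius r nearest to 0 lies in the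
  image of the disk; its preimage has length at least \<Phi> r in the metric with density \<Phi>'.\<close>
theorem univalent_growth:
  fixes \<Phi> \<Phi>' :: "real \<Rightarrow> real"
  assumes F: "F holomorphic_on unit_disk" "inj_on F unit_disk" "F 0 = 0"
    and \<Phi>0: "\<Phi> 0 = 0"
    and \<Phi>: "\<And>r. 0 \<le> r \<Longrightarrow> r < 1 \<Longrightarrow> (\<Phi> has_real_derivative \<Phi>' r) (at r)"
    and pos: "\<And>r. 0 \<le> r \<Longrightarrow> r < 1 \<Longrightarrow> \<Phi>' r \<ge> 0"
    and dF: "\<And>z. norm z < 1 \<Longrightarrow> norm (deriv F z) \<ge> \<Phi>' (norm z)"
    and z: "norm z < 1"
  shows "norm (F z) \<ge> \<Phi> (norm z)"
proof (cases "z = 0")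
  case False
  define r where "r = norm z"
  have r: "0 < r" "r < 1" using z False by (auto simp: r_def)
  have sub: "cball 0 r \<subseteq> unit_disk" using r by auto
  have opF: "open (F ` S)" if "open S" "S \<subseteq> unit_disk" for S
    by (rule open_mapping_thm3) (use that F in \<open>auto intro: holomorphic_on_subset inj_on_subset\<close>)
  obtain k where k: "k holomorphic_on F ` unit_disk"
      "\<And>z. z \<in> unit_disk \<Longrightarrow> deriv F z * deriv k (F z) = 1"
      "\<And>z. z \<in> unit_disk \<Longrightarrow> k (F z) = z"
    using holomorphic_has_inverse[OF F(1) _ F(2)] by auto
  have contF: "continuous_on (cball 0 r) F"
    using F(1) sub by (meson holomorphic_on_imp_continuous_on holomorphic_on_subset)
  have "continuous_on (sphere 0 r) (\<lambda>z. norm (F z))"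
    by (intro continuous_on_norm continuous_on_subset[OF contF]) auto
  moreover have "sphere (0::complex) r \<noteq> {}" using r_def by force
  ultimately have "\<exists>x\<in>sphere 0 r. \<forall>y\<in>sphere 0 r. norm (F x) \<le> norm (F y)"
    by (intro continuous_attains_inf) auto
  then obtain z1 where z1: "norm z1 = r" and min: "\<And>y. norm y = r \<Longrightarrow> norm (F z1) \<le> norm (F y)"
    by auto
  define m where "m = norm (F z1)"
  have F1nz: "F z1 \<noteq> 0" using F(2,3) z1 r by (metis inj_on_eq_iff centre_in_ball mem_ball_0 norm_zero zero_less_one less_irrefl)
  \<comment> \<open>On the sphere of radius r the modulus of F is at least m. Inside
    \<open>ball 0 m\<close> the images of the open and of the closed disk of radius r therefore
    agree, so this part of the image is both open and closed in a connected set.\<close>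
  have ball: "ball 0 m \<subseteq> F ` ball 0 r"
  proof -
    have "y \<in> ball 0 r" if "y \<in> cball 0 r" "F y \<in> ball 0 m" for y
      using that min[of y] by (cases "norm y = r") (auto simp: m_def)
    then have "ball 0 m \<inter> F ` ball 0 r = ball 0 m \<inter> F ` cball 0 r" by auto
    moreover have "closed (F ` cball 0 r)"
      by (intro compact_imp_closed compact_continuous_image contF) auto
    ultimately have "closedin (top_of_set (ball 0 m)) (ball 0 m \<inter> F ` ball 0 r)"
      by (metis closedin_closed_Int)
    moreover have "open (F ` ball 0 r)" using opF[of "ball 0 r"] r subset_ball[of r 1 0] by simp
    then have "openin (top_of_set (ball 0 m)) (ball 0 m \<inter> F ` ball 0 r)"
      by (rule openin_open_Int)
    moreover have "0 \<in> ball 0 m \<inter> F ` ball 0 r"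
      using F(3) F1nz r by (auto simp: m_def image_iff intro!: bexI[of _ 0])
    moreover have "connected (ball (0::complex) m)" by simp
    ultimately have "ball 0 m \<inter> F ` ball 0 r = ball 0 m"
      unfolding connected_clopen by blast
    then show ?thesis by blast
  qed
  have seg: "of_real s * F z1 \<in> F ` unit_disk" if s: "0 \<le> s" "s \<le> 1" for s
  proof (cases "s = 1")
    case True then show ?thesis using z1 r by auto
  next
    case False
    with s F1nz have "of_real s * F z1 \<in> ball 0 m" by (simp add: m_def norm_mult)
    then show ?thesis using ball r by auto
  qed
  have opi: "open (F ` unit_disk)" using opF[of unit_disk] by auto
  \<comment> \<open>Compares \<open>\<Phi>\<close> at the modulus of the preimage with the length s
    * m of the segment covered so far. It cannot increase: \<open>\<Phi>'\<close> is at most |F'|,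
    and k' is the reciprocal of F'. It equals 0 at s = 0 and \<open>\<Phi>\<close> r - m at s =
    1.\<close>
  define u where "u = (\<lambda>s::real. \<Phi> (norm (k (of_real s * F z1))) - s * m)"
  have kin: "norm (k (of_real s * F z1)) < 1" "F (k (of_real s * F z1)) = of_real s * F z1"
    if "0 \<le> s" "s \<le> 1" for s
    using seg[OF that] k(3) by auto
  have "u 1 \<le> u 0"
  \<comment> \<open>The derivative is taken only in the open interval: at s = 0 the preimage is 0,
    where the modulus is not differentiable.\<close>
  proof (rule DERIV_nonpos_imp_decreasing_open[where f = u])
    fix s :: real assume s: "0 < s" "s < 1"
    let ?v = "k (of_real s * F z1)"
    have v: "norm ?v < 1" "F ?v = of_real s * F z1" using kin s by auto
    have v0: "?v \<noteq> 0" using v(2) F(3) F1nz s by auto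
    have kd: "(k has_field_derivative deriv k (of_real s * F z1)) (at (of_real s * F z1))"
      using k(1) seg[of s] s opi by (auto intro: holomorphic_derivI)
    obtain d where d: "((\<lambda>s. norm (k (of_real s * F z1))) has_real_derivative d) (at s)"
      "d \<le> norm (deriv k (of_real s * F z1) * F z1)"
      using norm_along_path_derivative[OF kd v0] by blast
    have "\<Phi>' (norm ?v) * d \<le> norm (deriv F ?v) * norm (deriv k (of_real s * F z1) * F z1)"
      by (rule order_trans[OF mult_left_mono[OF d(2)] mult_right_mono]) (use dF pos v in auto)
    also have "\<dots> = m"
    proof -
      have "deriv F ?v * (deriv k (of_real s * F z1) * F z1) = F z1"
        using k(2)[of ?v] v by (simp flip: mult.assoc)
      then show ?thesis by (metis m_def norm_mult)
    qed
    finally have le: "\<Phi>' (norm ?v) * d - m \<le> 0" by simp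
    have "(u has_real_derivative \<Phi>' (norm ?v) * d - m) (at s)"
    proof -
      have "((\<lambda>s. \<Phi> (norm (k (of_real s * F z1)))) has_real_derivative \<Phi>' (norm ?v) * d) (at s)"
        using DERIV_chain2[OF \<Phi>[of "norm ?v"] d(1)] v by simp
      moreover have "((\<lambda>s. s * m) has_real_derivative m) (at s)"
        by (auto intro!: derivative_eq_intros)
      ultimately show ?thesis unfolding u_def by (rule DERIV_diff)
    qed
    with le show "\<exists>y. (u has_real_derivative y) (at s) \<and> y \<le> 0" by blast
  next
    have lin: "continuous_on {0..1} (\<lambda>s::real. of_real s * F z1)" by (intro continuous_intros)
    have contk: "continuous_on {0..1} (\<lambda>s::real. norm (k (of_real s * F z1)))"
      by (rule continuous_on_norm[OF continuous_on_compose2[OF holomorphic_on_imp_continuous_on[OF k(1)] lin]])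
         (use seg in \<open>simp add: image_subset_iff\<close>)
    have cont\<Phi>: "continuous_on {0..<1} \<Phi>"
      using \<Phi> by (intro continuous_at_imp_continuous_on ballI DERIV_isCont) auto
    have "continuous_on {0..1} (\<lambda>s::real. \<Phi> (norm (k (of_real s * F z1))))"
      by (rule continuous_on_compose2[OF cont\<Phi> contk]) (use kin in auto)
    then show "continuous_on {0..1} u"
      unfolding u_def by (intro continuous_intros)
  qed simp
  moreover have "u 1 = \<Phi> r - m" using k(3)[of z1] z1 r by (simp add: u_def)
  moreover have "u 0 = 0" using k(3)[of 0] F(3) \<Phi>0 by (simp add: u_def)
  ultimately show ?thesis using min[of z] by (simp add: m_def r_def)
qed (use F \<Phi>0 in simp)

subsection \<open>Univalence\<close>

text \<open>The Noshiro-Warschawski argument on the convex image of g: h composed with the inverse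
  of g has derivative h' / g', so Re (h / w) strictly increases along the segment from g b to g a of
  direction w.\<close>

lemma chord_quotient_Re_pos:
  assumes h: "h holomorphic_on unit_disk" and g: "convex_function g"
    and pos: "\<And>z. norm z < 1 \<Longrightarrow> Re (deriv h z / deriv g z) > 0"
    and ab: "norm a < 1" "norm b < 1" "a \<noteq> b"
  shows "Re ((h a - h b) / (g a - g b)) > 0"
proof -
  have hg: "g holomorphic_on unit_disk" and inj: "inj_on g unit_disk" and conv: "convex (g ` unit_disk)"
    using g by (auto simp: convex_function_def)
  obtain k where k: "k holomorphic_on g ` unit_disk"
      "\<And>z. z \<in> unit_disk \<Longrightarrow> deriv g z * deriv k (g z) = 1"
      "\<And>z. z \<in> unit_disk \<Longrightarrow> k (g z) = z"
    using holomorphic_has_inverse[OF hg _ inj] by auto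
  have opg: "open (g ` unit_disk)"
    by (rule open_mapping_thm3) (use hg inj in auto)
  define w where "w = g a - g b"
  have w: "w \<noteq> 0" using inj ab by (auto simp: w_def inj_on_eq_iff)
  define u where "u = (\<lambda>s::real. Re (h (k (g b + of_real s * w)) / w))"
  have seg: "g b + of_real s * w \<in> g ` unit_disk" if "0 \<le> s" "s \<le> 1" for s
  proof -
    have "(1 - s) *\<^sub>R g b + s *\<^sub>R g a \<in> g ` unit_disk"
      using that ab by (intro convexD[OF conv]) auto
    then show ?thesis by (simp add: w_def scaleR_conv_of_real algebra_simps)
  qed
  have "u 0 < u 1"
  proof (rule DERIV_pos_imp_increasing[where f = u])
    fix s :: real assume s: "0 \<le> s" "s \<le> 1"
    obtain v where v: "norm v < 1" "g b + of_real s * w = g v" using seg[OF s] by auto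
    have kv: "k (g b + of_real s * w) = v" using k(3)[of v] v by simp
    have dk: "(k has_field_derivative deriv k (g v)) (at (g b + of_real s * w))"
      using k(1) v opg by (auto intro!: holomorphic_derivI[of k "g ` unit_disk"])
    have dh: "(h has_field_derivative deriv h v) (at (k (g b + of_real s * w)))"
      using h v kv by (auto intro!: holomorphic_derivI[of _ unit_disk])
    have "((\<lambda>s. g b + of_real s * w) has_vector_derivative w) (at s)"
      by (auto intro!: derivative_eq_intros has_vector_derivative_real_field)
    from field_vector_diff_chain_at[OF this DERIV_cdivide[OF DERIV_chain2[OF dh dk], of w]]
    have "((\<lambda>s. h (k (g b + of_real s * w)) / w) has_vector_derivative w * (deriv h v * deriv k (g v) / w)) (at s)"
      by (simp only: o_def)
    then have "(u has_real_derivative Re (w * (deriv h v * deriv k (g v) / w))) (at s)"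
      unfolding u_def has_real_derivative_iff_has_vector_derivative
      by (rule bounded_linear.has_vector_derivative[OF bounded_linear_Re])
    moreover have "w * (deriv h v * deriv k (g v) / w) = deriv h v / deriv g v"
      using k(2)[of v] v w convex_function_deriv_nonzero[OF g, of v] by (simp add: field_simps)
    ultimately show "\<exists>y. (u has_real_derivative y) (at s) \<and> 0 < y"
      using pos[OF v(1)] by auto
  qed simp
  moreover have "u 1 = Re (h a / w)" "u 0 = Re (h b / w)"
    using k(3)[of a] k(3)[of b] ab by (auto simp: u_def w_def)
  ultimately show ?thesis by (simp add: w_def diff_divide_distrib)
qed

section \<open>Starlikeness of convex functions\<close>

lemma has_real_derivative_norm_power2:
  fixes \<gamma> :: "real \<Rightarrow> complex"
  assumes "(\<gamma> has_vector_derivative \<gamma>') (at s)"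
  shows "((\<lambda>s. (norm (\<gamma> s))\<^sup>2) has_real_derivative 2 * inner (\<gamma> s) \<gamma>') (at s)"
proof -
  have "(\<gamma> has_derivative (\<lambda>h. h *\<^sub>R \<gamma>')) (at s)"
    using assms by (simp add: has_vector_derivative_def)
  from has_derivative_inner[OF this this] show ?thesis
    unfolding has_field_derivative_def power2_norm_eq_inner
    by (elim has_derivative_eq_rhs) (simp add: fun_eq_iff inner_commute)
qed

lemma inner_eq_Re_cnj: "inner z w = Re (cnj z * w)" for z w :: complex
  by (simp add: inner_complex_def)

lemma Re_of_real_divide: "Re (of_real c / w) = c * Re w / (norm w)\<^sup>2"
  by (simp add: Re_divide cmod_power2)

text \<open>For s in [0, 1] the function s g is subordinate to g, by convexity and g 0 = 0. Hence |k
  (s g z)|, with k the inverse of g, is largest at s = 1. Its square thus has a nonnegative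
  derivative there, which is 2 Re (cnj z * g z / g' z) and has the sign of Re (z g' / g).\<close>

lemma convex_function_starlike:
  assumes g: "convex_function g" and g0: "g 0 = 0" and z: "norm z < 1"
  shows "Re (z * deriv g z / g z) \<ge> 0"
proof -
  have hg: "g holomorphic_on unit_disk" and inj: "inj_on g unit_disk" and conv: "convex (g ` unit_disk)"
    using g by (auto simp: convex_function_def)
  obtain k where k: "k holomorphic_on g ` unit_disk"
      "\<And>z. z \<in> unit_disk \<Longrightarrow> deriv g z * deriv k (g z) = 1"
      "\<And>z. z \<in> unit_disk \<Longrightarrow> k (g z) = z"
    using holomorphic_has_inverse[OF hg _ inj] by auto
  have opg: "open (g ` unit_disk)"
    by (rule open_mapping_thm3) (use hg inj in auto)
  define N where "N = (\<lambda>s::real. (norm (k (of_real s * g z)))\<^sup>2)"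
  have le: "N s \<le> N 1" if s: "0 \<le> s" "s \<le> 1" for s
  proof -
    have img: "(\<lambda>x. of_real s * g x) ` unit_disk \<subseteq> g ` unit_disk"
    proof safe
      fix x :: complex assume x: "x \<in> unit_disk"
      have "(1 - s) *\<^sub>R g 0 + s *\<^sub>R g x \<in> g ` unit_disk"
        using s x by (intro convexD[OF conv]) auto
      then show "of_real s * g x \<in> g ` unit_disk" by (simp add: g0 scaleR_conv_of_real)
    qed
    have "norm (inv_into unit_disk g (of_real s * g z)) \<le> norm z"
      by (rule subordinate_norm_le(2)[OF hg inj _ _ img z]) (auto intro!: holomorphic_intros hg simp: g0)
    moreover obtain v where "norm v < 1" "of_real s * g z = g v" using img z by force
    ultimately have "norm (k (of_real s * g z)) \<le> norm z"
      using k(3)[of v] inj by (simp add: inv_into_f_f)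
    moreover have "N 1 = (norm z)\<^sup>2" using k(3)[of z] z by (simp add: N_def)
    ultimately show ?thesis by (simp add: N_def power_mono)
  qed
  have dk: "(k has_field_derivative deriv k (g z)) (at (of_real 1 * g z))"
    using k(1) z opg by (auto intro!: holomorphic_derivI[of k "g ` unit_disk"])
  have "((\<lambda>s. of_real s * g z) has_vector_derivative g z) (at 1)"
    by (auto intro!: derivative_eq_intros has_vector_derivative_real_field)
  from has_real_derivative_norm_power2[OF field_vector_diff_chain_at[OF this dk]]
  have dN: "(N has_real_derivative 2 * inner z (g z * deriv k (g z))) (at 1)"
    using k(3)[of z] z by (simp add: N_def o_def)
  have "inner z (g z * deriv k (g z)) \<ge> 0"
  proof (rule ccontr)
    assume "\<not> inner z (g z * deriv k (g z)) \<ge> 0"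
    then obtain d where d: "d > 0" "\<And>h. 0 < h \<Longrightarrow> h < d \<Longrightarrow> N 1 < N (1 - h)"
      using DERIV_neg_dec_left[OF dN] by auto
    define h where "h = min (d / 2) 1"
    have "0 < h" "h < d" "h \<le> 1" using d(1) by (auto simp: h_def)
    then show False using d(2)[of h] le[of "1 - h"] by auto
  qed
  also have "deriv k (g z) = inverse (deriv g z)"
    using k(2)[of z] z by (metis inverse_unique mem_ball_0)
  finally have X: "Re (cnj z * (g z * inverse (deriv g z))) \<ge> 0"
    by (simp only: inner_eq_Re_cnj)
  show ?thesis
  \<comment> \<open>At z = 0 the quotient is 0 / 0, which has the value 0 here, so the weak
    inequality includes this point.\<close>
  proof (cases "z = 0 \<or> g z = 0")
    case False
    have "z * deriv g z / g z = of_real ((norm z)\<^sup>2) / (cnj z * (g z * inverse (deriv g z)))"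
      using False convex_function_deriv_nonzero[OF g z] by (simp add: complex_norm_square field_simps del: of_real_power)
    then show ?thesis using X by (simp only: Re_of_real_divide) simp
  qed auto
qed

text \<open>The difference quotient of f, extended to the diagonal by the derivative. As an integral
  over a parameter it is jointly continuous there as well, which the compactness argument for
  univalence needs.\<close>

definition chord_slope :: "(complex \<Rightarrow> complex) \<Rightarrow> complex \<Rightarrow> complex \<Rightarrow> complex"
  where "chord_slope f a b = integral {0..1} (\<lambda>s::real. deriv f (b + of_real s * (a - b)))"

lemma chord_slope_same [simp]: "chord_slope f a a = deriv f a"
  by (simp add: chord_slope_def)

lemma segment_in_ball:
  fixes a b :: complex
  assumes "norm a < 1" "norm b < 1" "0 \<le> s" "s \<le> 1"
  shows "norm (b + of_real s * (a - b)) < 1"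
proof -
  have "(1 - s) *\<^sub>R b + s *\<^sub>R a \<in> unit_disk"
    by (rule convexD) (use assms in auto)
  then show ?thesis by (simp add: scaleR_conv_of_real algebra_simps)
qed

lemma chord_slope_mult:
  assumes f: "f holomorphic_on unit_disk" and ab: "norm a < 1" "norm b < 1"
  shows "chord_slope f a b * (a - b) = f a - f b"
proof -
  have "((\<lambda>s. deriv f (b + of_real s * (a - b)) * (a - b)) has_integral
      f (b + of_real 1 * (a - b)) - f (b + of_real 0 * (a - b))) {0..1}"
  proof (rule fundamental_theorem_of_calculus)
    fix s :: real assume s: "s \<in> {0..1}"
    have "((\<lambda>s. b + of_real s * (a - b)) has_vector_derivative (a - b)) (at s)"
      by (auto intro!: derivative_eq_intros has_vector_derivative_real_field)
    moreover have "(f has_field_derivative deriv f (b + of_real s * (a - b))) (at (b + of_real s * (a - b)))"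
      using f segment_in_ball[OF ab] s by (intro holomorphic_derivI[of f unit_disk]) auto
    ultimately have "((f \<circ> (\<lambda>s. b + of_real s * (a - b))) has_vector_derivative
        (a - b) * deriv f (b + of_real s * (a - b))) (at s)"
      by (rule field_vector_diff_chain_at)
    then show "((\<lambda>s. f (b + of_real s * (a - b))) has_vector_derivative
        deriv f (b + of_real s * (a - b)) * (a - b)) (at s within {0..1})"
      unfolding o_def by (simp add: mult.commute has_vector_derivative_at_within)
  qed simp
  from integral_unique[OF this] show ?thesis by (simp add: chord_slope_def)
qed

lemma continuous_on_chord_slope:
  assumes f: "f holomorphic_on unit_disk"
  shows "continuous_on (unit_disk \<times> unit_disk) (\<lambda>x. chord_slope f (fst x) (snd x))"
proof -
  have cont: "continuous_on unit_disk (deriv f)"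
    by (intro holomorphic_on_imp_continuous_on holomorphic_deriv f) auto
  have "continuous_on ((unit_disk \<times> unit_disk) \<times> cbox 0 1)
      (\<lambda>y. deriv f (snd (fst y) + of_real (snd y) * (fst (fst y) - snd (fst y))))"
    by (intro continuous_on_compose2[OF cont] continuous_intros) (auto intro!: segment_in_ball)
  then have "continuous_on ((unit_disk \<times> unit_disk) \<times> cbox 0 (1::real))
      (\<lambda>(x, s). deriv f (snd x + of_real s * (fst x - snd x)))"
    by (simp add: case_prod_beta)
  from integral_continuous_on_param[OF this] show ?thesis
    by (simp add: chord_slope_def)
qed

text \<open>Univalence by following the family f + t g. If f + t g identifies two points, moving both of
  them along the level sets of f + t g as t grows decreases their moduli. Hence the largest t for
  which two points of a compact disk are identified could still be increased.\<close>
theorem close_to_starlike_univalent: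
  assumes f: "f holomorphic_on unit_disk" "f 0 = 0"
    and g: "g holomorphic_on unit_disk" "inj_on g unit_disk" "g 0 = 0"
    and fg: "\<And>z. norm z < 1 \<Longrightarrow> z \<noteq> 0 \<Longrightarrow> Re (z * deriv f z / g z) > 0"
    and star: "\<And>z. norm z < 1 \<Longrightarrow> Re (z * deriv g z / g z) \<ge> 0"
    and fg0: "Re (deriv f 0 / deriv g 0) > 0"
  shows "inj_on f unit_disk"
proof (rule inj_onI, rule ccontr)
  fix a0 b0 assume a0: "a0 \<in> unit_disk" and b0: "b0 \<in> unit_disk" and eq0: "f a0 = f b0" and ne0: "a0 \<noteq> b0"
  have gnz: "g z \<noteq> 0" if "norm z < 1" "z \<noteq> 0" for z
    using that g(2,3) inj_onD[OF g(2), of z 0] by auto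
  have dg: "deriv g z \<noteq> 0" if "norm z < 1" for z
    using that g by (intro holomorphic_injective_imp_regular[of _ unit_disk]) auto
  have quot: "Re (z * (deriv f z + of_real t * deriv g z) / g z) > 0"
    if "norm z < 1" "z \<noteq> 0" "t \<ge> 0" for z and t :: real
  proof -
    have "z * (deriv f z + of_real t * deriv g z) / g z = z * deriv f z / g z + of_real t * (z * deriv g z / g z)"
      by (simp add: algebra_simps add_divide_distrib)
    then show ?thesis
      using fg[OF that(1,2)] mult_nonneg_nonneg[OF that(3) star[OF that(1)]]
      by (simp del: times_divide_eq_right)
  qed
  have dnz: "deriv f z + of_real t * deriv g z \<noteq> 0" if z: "norm z < 1" and t: "t \<ge> 0" for z and t :: real
  proof (cases "z = 0")
    \<comment> \<open>The quotient with numerator z carries no information at 0; the assumption on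
      the derivatives at 0 takes its place.\<close>
    case True
    show ?thesis
    proof
      assume "deriv f z + of_real t * deriv g z = 0"
      then have "deriv f 0 / deriv g 0 = of_real (- t)"
        using True dg[of 0] by (simp add: field_simps add_eq_0_iff)
      with fg0 t show False by simp
    qed
  next
    case False
    then show ?thesis using quot[OF z _ t] by auto
  qed
  have step: "\<exists>k::real \<Rightarrow> complex. (k \<longlongrightarrow> a) (at_right t0) \<and>
      (\<forall>\<^sub>F t in at_right t0. norm (k t) \<le> norm a \<and> f (k t) + of_real t * g (k t) = f a + of_real t0 * g a)"
    if a: "norm a < 1" and t0: "t0 \<ge> 0" for a and t0 :: real
  proof (cases "a = 0")
    case True
    \<comment> \<open>Both functions vanish at 0, so the constant path stays on the level
      set.\<close>
    then show ?thesis by (intro exI[of _ "\<lambda>_. 0"]) (simp add: f g)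
  next
    case False
    define c where "c = f a + of_real t0 * g a"
    \<comment> \<open>The equation f x + t * g x = c solved for t. Near a this is invertible, and
      its inverse \<open>k\<close>, restricted to real t, is the required path.\<close>
    define \<tau> where "\<tau> = (\<lambda>x. (c - f x) / g x)"
    define D where "D = deriv f a + of_real t0 * deriv g a"
    have D: "D \<noteq> 0" using dnz[OF a t0] by (simp add: D_def)
    let ?S = "unit_disk - {0}"
    have S: "open ?S" "a \<in> ?S" using a False by (auto simp: open_delete)
    have \<tau>: "\<tau> holomorphic_on ?S"
      unfolding \<tau>_def using gnz
      by (intro holomorphic_intros holomorphic_on_subset[OF f(1)] holomorphic_on_subset[OF g(1)]) auto
    have \<tau>a: "\<tau> a = of_real t0" using gnz[OF a False] by (simp add: \<tau>_def c_def)
    have "(\<tau> has_field_derivative ((0 - deriv f a) * g a - (c - f a) * deriv g a) / (g a * g a)) (at a)"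
      unfolding \<tau>_def using a f g gnz[OF a False]
      by (intro DERIV_divide DERIV_diff DERIV_const holomorphic_derivI[of _ unit_disk]) auto
    then have d\<tau>: "deriv \<tau> a = - D / g a"
      using gnz[OF a False] by (simp add: DERIV_imp_deriv c_def D_def field_simps)
    then have "deriv \<tau> a \<noteq> 0" using D gnz[OF a False] by simp
    then obtain r where r: "r > 0" "ball a r \<subseteq> ?S" "inj_on \<tau> (ball a r)"
      using has_complex_derivative_locally_injective[OF \<tau> S(2,1)] by metis
    have \<tau>r: "\<tau> holomorphic_on ball a r" using \<tau> r(2) by (rule holomorphic_on_subset)
    obtain k where k: "k holomorphic_on \<tau> ` ball a r"
      "\<And>z. z \<in> ball a r \<Longrightarrow> deriv \<tau> z * deriv k (\<tau> z) = 1"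
      "\<And>z. z \<in> ball a r \<Longrightarrow> k (\<tau> z) = z"
      using holomorphic_has_inverse[OF \<tau>r _ r(3)] by auto
    have op: "open (\<tau> ` ball a r)" by (rule open_mapping_thm3) (use \<tau>r r in auto)
    have t0in: "of_real t0 \<in> \<tau> ` ball a r" using \<tau>a r(1) by (metis centre_in_ball imageI)
    have dk: "(k has_field_derivative deriv k (of_real t0)) (at (of_real t0))"
      using k(1) op t0in by (rule holomorphic_derivI)
    have kt0: "k (of_real t0) = a" using k(3)[of a] r(1) \<tau>a by simp
    have vd: "((\<lambda>t. k (of_real t)) has_vector_derivative deriv k (of_real t0)) (at t0)"
      using field_vector_diff_chain_at[of of_real 1 t0 k] dk
      by (auto simp: o_def intro!: has_vector_derivative_real_field derivative_eq_intros)
    have tend: "((\<lambda>t. k (of_real t)) \<longlongrightarrow> a) (at_right t0)"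
      using has_vector_derivative_continuous[OF vd] kt0
      by (metis continuous_within tendsto_within_subset subset_UNIV)
    have "deriv k (of_real t0) = - g a / D"
      using k(2)[of a] r(1) d\<tau> \<tau>a D gnz[OF a False] by (simp add: field_simps) (metis add.inverse_inverse)
    \<comment> \<open>Rewriting cnj a * g a / D as |a|^2 over a * D / g a reduces the sign to
      \<open>quot\<close>, because reciprocals preserve the sign of the real part. So |k| strictly
      decreases at t0.\<close>
    then have "inner a (deriv k (of_real t0)) = - Re (cnj a * (g a / D))"
      by (simp only: inner_eq_Re_cnj minus_divide_left [symmetric] mult_minus_right uminus_complex.sel)
    also have "cnj a * (g a / D) = of_real ((norm a)\<^sup>2) / (a * D / g a)"
      using False D gnz[OF a False] by (simp add: complex_norm_square field_simps del: of_real_power)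
    also have "- Re (of_real ((norm a)\<^sup>2) / (a * D / g a)) < 0"
      unfolding Re_of_real_divide using quot[OF a False t0] False D gnz[OF a False]
      by (simp add: D_def zero_less_mult_iff zero_less_divide_iff)
    finally have "2 * inner (k (of_real t0)) (deriv k (of_real t0)) < 0" by (simp add: kt0)
    from DERIV_neg_dec_right[OF has_real_derivative_norm_power2[OF vd] this]
    obtain d where d: "d > 0" "\<And>h. 0 < h \<Longrightarrow> h < d \<Longrightarrow>
        (norm (k (of_real (t0 + h))))\<^sup>2 < (norm (k (of_real t0)))\<^sup>2" by blast
    have "\<forall>\<^sub>F t in at_right t0. t \<in> {t0<..<t0 + d}"
      using d(1) by (intro eventually_at_rightI[of _ "t0 + d"]) auto
    moreover have "((\<lambda>t. complex_of_real t) \<longlongrightarrow> of_real t0) (at_right t0)"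
      by (intro tendsto_intros)
    then have "\<forall>\<^sub>F t in at_right t0. complex_of_real t \<in> \<tau> ` ball a r"
      using op t0in by (rule topological_tendstoD)
    ultimately have "\<forall>\<^sub>F t in at_right t0. norm (k (of_real t)) \<le> norm a \<and>
        f (k (of_real t)) + of_real t * g (k (of_real t)) = c"
    proof eventually_elim
      case (elim t)
      then have "(norm (k (of_real t)))\<^sup>2 < (norm a)\<^sup>2" using d(2)[of "t - t0"] kt0 by auto
      then have le: "norm (k (of_real t)) \<le> norm a" by (simp add: power2_le_imp_le)
      obtain x where x: "x \<in> ball a r" "of_real t = \<tau> x" using elim by blast
      moreover have "x \<in> ?S" using x(1) r(2) by blast
      ultimately have "k (of_real t) = x" "g x \<noteq> 0" using k(3) gnz by auto
      then have "f (k (of_real t)) + of_real t * g (k (of_real t)) = c"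
        using x(2) by (simp add: \<tau>_def)
      with le show ?case by blast
    qed
    with tend show ?thesis unfolding c_def by blast
  qed
  \<comment> \<open>Since moduli do not grow along the paths, a pair in this closed disk stays in
    it, at a positive distance from the unit circle.\<close>
  define r where "r = max (norm a0) (norm b0)"
  let ?K = "cball (0::complex) r"
  have r: "r < 1" using a0 b0 by (auto simp: r_def)
  have KD: "?K \<times> ?K \<subseteq> unit_disk \<times> unit_disk" using r by auto
  have ab0: "a0 \<in> ?K" "b0 \<in> ?K" by (auto simp: r_def)
  note contf = continuous_on_subset[OF continuous_on_chord_slope[OF f(1)] KD]
  note contg = continuous_on_subset[OF continuous_on_chord_slope[OF g(1)] KD]
  have gs: "chord_slope g a b \<noteq> 0" if "norm a < 1" "norm b < 1" for a b
  proof (cases "a = b")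
    case False
    then have "g a \<noteq> g b" using g(2) that by (auto simp: inj_on_eq_iff)
    then show ?thesis using chord_slope_mult[OF g(1) that] by auto
  qed (use dg that in simp)
  have cpt: "compact (?K \<times> ?K)" by (intro compact_Times compact_cball)
  have ne: "?K \<times> ?K \<noteq> {}" using ab0 by blast
  obtain x where x: "x \<in> ?K \<times> ?K"
    "\<And>y. y \<in> ?K \<times> ?K \<Longrightarrow> norm (chord_slope g (fst x) (snd x)) \<le> norm (chord_slope g (fst y) (snd y))"
    using continuous_attains_inf[OF cpt ne continuous_on_norm[OF contg]] by blast
  obtain y where y: "y \<in> ?K \<times> ?K"
    "\<And>x. x \<in> ?K \<times> ?K \<Longrightarrow> norm (chord_slope f (fst x) (snd x)) \<le> norm (chord_slope f (fst y) (snd y))"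
    using continuous_attains_sup[OF cpt ne continuous_on_norm[OF contf]] by blast
  define m where "m = norm (chord_slope g (fst x) (snd x))"
  define M where "M = norm (chord_slope f (fst y) (snd y)) / m"
  have m: "m > 0" using gs[of "fst x" "snd x"] x(1) KD by (auto simp: m_def)
  \<comment> \<open>The slopes of g stay away from 0 on the compact set because g is univalent,
    which limits the t at which a slope of f + t g can vanish.\<close>
  have bound: "t \<le> M" if "a \<in> ?K" "b \<in> ?K" "t \<ge> 0" and e: "chord_slope f a b + of_real t * chord_slope g a b = 0"
    for a b t
  proof -
    have "t * m \<le> t * norm (chord_slope g a b)"
      using x(2)[of "(a, b)"] that by (intro mult_left_mono) (auto simp: m_def)
    also have "\<dots> = norm (chord_slope f a b)"
      using e that(3) by (simp add: add_eq_0_iff2 norm_mult)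
    also have "\<dots> \<le> M * m" using y(2)[of "(a, b)"] that m by (auto simp: M_def)
    finally show ?thesis using m by simp
  qed
  \<comment> \<open>Vanishing slopes instead of pairs of distinct identified points: requiring a and
    b to be distinct would not give a closed set.\<close>
  define X where "X = {x \<in> {0..M} \<times> (?K \<times> ?K). chord_slope f (fst (snd x)) (snd (snd x)) +
      of_real (fst x) * chord_slope g (fst (snd x)) (snd (snd x)) = 0}"
  have inX: "(t, a, b) \<in> X" if "a \<in> ?K" "b \<in> ?K" "t \<ge> 0" "a \<noteq> b"
    and e: "f a + of_real t * g a = f b + of_real t * g b" for t a b
  proof -
    have ab: "norm a < 1" "norm b < 1" using that r by auto
    have "(chord_slope f a b + of_real t * chord_slope g a b) * (a - b) = (f a - f b) + of_real t * (g a - g b)"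
      by (simp only: distrib_right mult.assoc chord_slope_mult[OF f(1) ab] chord_slope_mult[OF g(1) ab])
    also have "\<dots> = 0" using e by (simp add: algebra_simps)
    finally have "chord_slope f a b + of_real t * chord_slope g a b = 0" using that(4) by simp
    with bound[OF that(1-3) this] that show ?thesis by (simp add: X_def)
  qed
  have "closed X"
    unfolding X_def
  proof (rule continuous_closed_preimage_constant)
    have "continuous_on ({0..M} \<times> (?K \<times> ?K)) (\<lambda>x. chord_slope f (fst (snd x)) (snd (snd x)))"
      by (rule continuous_on_compose2[OF contf]) (auto intro!: continuous_intros)
    moreover have "continuous_on ({0..M} \<times> (?K \<times> ?K)) (\<lambda>x. chord_slope g (fst (snd x)) (snd (snd x)))"
      by (rule continuous_on_compose2[OF contg]) (auto intro!: continuous_intros)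
    ultimately show "continuous_on ({0..M} \<times> (?K \<times> ?K)) (\<lambda>x. chord_slope f (fst (snd x)) (snd (snd x)) +
      of_real (fst x) * chord_slope g (fst (snd x)) (snd (snd x)))"
      by (intro continuous_intros)
    show "closed ({0..M} \<times> (?K \<times> ?K))" by (intro closed_Times) auto
  qed
  moreover have "compact ({0..M} \<times> (?K \<times> ?K))" by (intro compact_Times) auto
  moreover have "X \<subseteq> {0..M} \<times> (?K \<times> ?K)" by (auto simp: X_def)
  ultimately have "compact X" by (metis compact_Int_closed inf.absorb2)
  moreover have "X \<noteq> {}" using inX[OF ab0 order_refl ne0] eq0 by auto
  ultimately obtain w where w: "w \<in> X" and max: "\<And>v. v \<in> X \<Longrightarrow> fst v \<le> fst w"
    using continuous_attains_sup[of X fst] continuous_on_fst[OF continuous_on_id, of X] by blast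
  obtain t0 a b where w_eq: "w = (t0, a, b)" by (metis prod_cases3)
  have t0: "t0 \<ge> 0" and aK: "a \<in> ?K" and bK: "b \<in> ?K" and e: "chord_slope f a b + of_real t0 * chord_slope g a b = 0"
    using w by (auto simp: X_def w_eq)
  have ab1: "norm a < 1" "norm b < 1" using aK bK r by auto
  \<comment> \<open>On the diagonal the slope equation reads f' + t0 g' = 0, contrary to
    \<open>dnz\<close>, so the maximal t belongs to two genuinely distinct points.\<close>
  have ne: "a \<noteq> b" using e dnz[OF ab1(1) t0] by auto
  have "f a + of_real t0 * g a - (f b + of_real t0 * g b) =
      (chord_slope f a b + of_real t0 * chord_slope g a b) * (a - b)"
    unfolding distrib_right mult.assoc chord_slope_mult[OF f(1) ab1] chord_slope_mult[OF g(1) ab1]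
    by (simp add: algebra_simps)
  then have lev: "f a + of_real t0 * g a = f b + of_real t0 * g b" using e by simp
  obtain ka where ka: "(ka \<longlongrightarrow> a) (at_right t0)"
    "\<forall>\<^sub>F t in at_right t0. norm (ka t) \<le> norm a \<and> f (ka t) + of_real t * g (ka t) = f a + of_real t0 * g a"
    using step[OF ab1(1) t0] by blast
  obtain kb where kb: "(kb \<longlongrightarrow> b) (at_right t0)"
    "\<forall>\<^sub>F t in at_right t0. norm (kb t) \<le> norm b \<and> f (kb t) + of_real t * g (kb t) = f b + of_real t0 * g b"
    using step[OF ab1(2) t0] by blast
  \<comment> \<open>The two paths have different limits, hence stay distinct for t slightly above t0
    and give an element of \<open>X\<close> with larger t.\<close>
  have "((\<lambda>t. ka t - kb t) \<longlongrightarrow> a - b) (at_right t0)" by (intro tendsto_diff ka kb)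
  then have "\<forall>\<^sub>F t in at_right t0. ka t - kb t \<noteq> 0"
    using ne by (intro tendsto_imp_eventually_ne) auto
  moreover have "\<forall>\<^sub>F t in at_right t0. t0 < t" by (rule eventually_at_right_less)
  ultimately have "\<forall>\<^sub>F t in at_right t0. t0 < t \<and> (t, ka t, kb t) \<in> X"
    using ka(2) kb(2)
  proof eventually_elim
    case (elim t)
    have "(t, ka t, kb t) \<in> X" by (rule inX) (use elim aK bK t0 lev in auto)
    with elim show ?case by simp
  qed
  then obtain t where "t0 < t" "(t, ka t, kb t) \<in> X"
    using eventually_happens[of _ "at_right t0"] by auto
  with max show False by (force simp: w_eq)
qed

subsection \<open>The class of quasi-convex functions\<close>

lemma class_C2_basic:
  assumes "f \<in> class_C2"
  shows "f holomorphic_on unit_disk" "f 0 = 0" "deriv f 0 = 1"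
    and "(\<lambda>w. w * deriv f w) holomorphic_on unit_disk" "deriv (\<lambda>w. w * deriv f w) 0 = 1"
proof -
  show f: "f holomorphic_on unit_disk" "f 0 = 0" and f': "deriv f 0 = 1"
    using assms by (auto simp: class_C2_def)
  have df: "deriv f holomorphic_on unit_disk" by (intro holomorphic_deriv f) auto
  then show "(\<lambda>w. w * deriv f w) holomorphic_on unit_disk"
    by (rule holomorphic_on_mult[OF holomorphic_on_ident])
  have "((\<lambda>w. w * deriv f w) has_field_derivative 0 * deriv (deriv f) 0 + 1 * deriv f 0) (at 0)"
    by (auto intro!: derivative_eq_intros holomorphic_derivI[OF df])
  then show "deriv (\<lambda>w. w * deriv f w) 0 = 1" using f' by (simp add: DERIV_imp_deriv)
qed

lemma class_C2E:
  assumes "f \<in> class_C2"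
  obtains g where "convex_function g" "g 0 = 0" "Re (deriv g 0) > 0"
    "\<And>z. norm z < 1 \<Longrightarrow> Re (deriv (\<lambda>w. w * deriv f w) z / deriv g z) > 0"
  using assms unfolding class_C2_def by auto

lemma taylor_coeff_mult_deriv:
  assumes f: "f holomorphic_on unit_disk"
  shows "taylor_coeff (\<lambda>w. w * deriv f w) n = of_nat n * taylor_coeff f n"
proof -
  have "f has_fps_expansion fps_expansion f 0"
    by (rule has_fps_expansion_fps_expansion[of unit_disk]) (use f in auto)
  then have "(\<lambda>w. w * deriv f w) has_fps_expansion fps_X * fps_deriv (fps_expansion f 0)"
    by (intro fps_expansion_intros)
  from taylor_coeff_eqI[OF this, of n] show ?thesis
    by (cases n) (simp_all add: taylor_coeff_def)
qed

lemma class_C2_coeff: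
  assumes f: "f \<in> class_C2"
  shows "norm (taylor_coeff (\<lambda>w. w * deriv f w) n) \<le> real n"
    and "norm (taylor_coeff f n) \<le> (if n = 0 then 0 else 1)"
proof -
  note f' = class_C2_basic[OF f]
  obtain g where g: "convex_function g" "g 0 = 0" "Re (deriv g 0) > 0"
    "\<And>z. norm z < 1 \<Longrightarrow> Re (deriv (\<lambda>w. w * deriv f w) z / deriv g z) > 0"
    using class_C2E[OF f] by metis
  show le: "norm (taylor_coeff (\<lambda>w. w * deriv f w) n) \<le> real n"
  proof (cases "n = 0")
    case False
    then show ?thesis using taylor_coeff_close_to_convex[OF f'(4) g(1,4), of n] f'(5) by simp
  qed simp
  show "norm (taylor_coeff f n) \<le> (if n = 0 then 0 else 1)"
  proof (cases "n = 0")
    case False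
    have "real n * norm (taylor_coeff f n) \<le> real n * 1"
      using le unfolding taylor_coeff_mult_deriv[OF f'(1)] by (simp add: norm_mult)
    then show ?thesis using False by simp
  qed (simp add: f')
qed

text \<open>For w f' a chord quotient of positive real part excludes equal values. The same quotient
  with b = 0 is z f' / g, the hypothesis that the criterion for f asks for.\<close>

theorem class_C2_univalent:
  assumes f: "f \<in> class_C2"
  shows "inj_on (\<lambda>w. w * deriv f w) unit_disk" "inj_on f unit_disk"
proof -
  note f' = class_C2_basic[OF f]
  obtain g where g: "convex_function g" "g 0 = 0" "Re (deriv g 0) > 0"
    "\<And>z. norm z < 1 \<Longrightarrow> Re (deriv (\<lambda>w. w * deriv f w) z / deriv g z) > 0"
    using class_C2E[OF f] by metis
  note chord = chord_quotient_Re_pos[OF f'(4) g(1,4)]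
  show "inj_on (\<lambda>w. w * deriv f w) unit_disk"
  proof (rule inj_onI, rule ccontr)
    fix a b assume "a \<in> unit_disk" "b \<in> unit_disk" "a * deriv f a = b * deriv f b" "a \<noteq> b"
    then show False using chord[of a b] by simp
  qed
  show "inj_on f unit_disk"
  proof (rule close_to_starlike_univalent)
    show "g holomorphic_on unit_disk" "inj_on g unit_disk"
      using g(1) by (auto simp: convex_function_def)
    show "Re (z * deriv f z / g z) > 0" if "norm z < 1" "z \<noteq> 0" for z
      using chord[of z 0] that g(2) by simp
    show "Re (z * deriv g z / g z) \<ge> 0" if "norm z < 1" for z
      using convex_function_starlike[OF g(1,2) that] .
    have "deriv g 0 \<noteq> 0" using g(3) by auto
    then show "Re (deriv f 0 / deriv g 0) > 0"
      using f'(3) g(3) Re_of_real_divide[of 1 "deriv g 0"] by simp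
  qed (use f' g in auto)
qed

text \<open>The comparison functions r / (1 + r)^2 and r / (1 + r) are the moduli at z = -r of the
  Koebe function z / (1 - z)^2 and of z / (1 - z).\<close>

theorem class_C2_growth:
  assumes f: "f \<in> class_C2" and z: "norm z < 1"
  shows "norm (f z) \<ge> norm z / (1 + norm z)"
proof -
  note f' = class_C2_basic[OF f]
  obtain g where g: "convex_function g" "g 0 = 0" "Re (deriv g 0) > 0"
    "\<And>z. norm z < 1 \<Longrightarrow> Re (deriv (\<lambda>w. w * deriv f w) z / deriv g z) > 0"
    using class_C2E[OF f] by metis
  have h: "norm w / (1 + norm w)\<^sup>2 \<le> norm (w * deriv f w)" if w: "norm w < 1" for w
  proof (rule univalent_growth[where \<Phi> = "\<lambda>r. r / (1 + r)\<^sup>2" and \<Phi>' = "\<lambda>r. (1 - r) / (1 + r) ^ 3"])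
    show "((\<lambda>r. r / (1 + r)\<^sup>2) has_real_derivative (1 - r) / (1 + r) ^ 3) (at r)" if "0 \<le> r" "r < 1" for r :: real
    proof -
      have "1 + r \<noteq> 0" using that by auto
      then have "((\<lambda>r. r / (1 + r)\<^sup>2) has_real_derivative
          (1 * (1 + r)\<^sup>2 - r * (2 * (1 + r))) / ((1 + r)\<^sup>2 * (1 + r)\<^sup>2)) (at r)"
        by (auto intro!: derivative_eq_intros)
      moreover have "1 * (1 + r)\<^sup>2 - r * (2 * (1 + r)) = (1 + r) * (1 - r)"
        "(1 + r)\<^sup>2 * (1 + r)\<^sup>2 = (1 + r) * (1 + r) ^ 3"
        by (simp_all add: power2_eq_square power3_eq_cube algebra_simps)
      ultimately show ?thesis by (simp only: mult_divide_mult_cancel_left[OF \<open>1 + r \<noteq> 0\<close>])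
    qed
    show "norm (deriv (\<lambda>w. w * deriv f w) w) \<ge> (1 - norm w) / (1 + norm w) ^ 3" if "norm w < 1" for w
      using close_to_convex_deriv_lower[OF f'(4) g(1,4) that] f'(5) by simp
    show "(1 - r) / (1 + r) ^ 3 \<ge> 0" if "0 \<le> r" "r < 1" for r :: real using that by simp
  qed (simp_all add: f'(4) class_C2_univalent(1)[OF f] w)
  have df: "norm (deriv f w) \<ge> 1 / (1 + norm w)\<^sup>2" if w: "norm w < 1" for w
  proof (cases "w = 0")
    case False
    have "norm w * (1 / (1 + norm w)\<^sup>2) \<le> norm w * norm (deriv f w)"
      using h[OF w] by (simp add: norm_mult)
    then show ?thesis by (rule mult_left_le_imp_le) (use False in simp)
  qed (simp add: f')
  show ?thesis
  proof (rule univalent_growth[where \<Phi> = "\<lambda>r. r / (1 + r)" and \<Phi>' = "\<lambda>r. 1 / (1 + r)\<^sup>2"])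
    show "((\<lambda>r. r / (1 + r)) has_real_derivative 1 / (1 + r)\<^sup>2) (at r)" if "0 \<le> r" "r < 1" for r :: real
      using that by (auto intro!: derivative_eq_intros simp: power2_eq_square)
    show "norm (deriv f w) \<ge> 1 / (1 + norm w)\<^sup>2" if "norm w < 1" for w using df[OF that] .
  qed (simp_all add: f'(1,2) class_C2_univalent(2)[OF f] z)
qed

text \<open>By the growth bound, values of modulus below c < 1/2 are taken only in a compact
  subdisk. Near such values the image is thus closed, while it is open everywhere, so it has no
  frontier point there.\<close>

theorem class_C2_infdist_frontier:
  assumes f: "f \<in> class_C2"
  shows "infdist (f 0) (frontier (f ` unit_disk)) \<ge> 1 / 2"
proof -
  note hol = class_C2_basic(1)[OF f] and f0 = class_C2_basic(2)[OF f]
  note inj = class_C2_univalent(2)[OF f]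
  have op: "open (f ` unit_disk)" by (rule open_mapping_thm3) (use hol inj in auto)
  have "f ` unit_disk \<noteq> UNIV"
  proof
    assume U: "f ` unit_disk = UNIV"
    obtain k where k: "k holomorphic_on f ` unit_disk" "\<And>z. z \<in> unit_disk \<Longrightarrow> k (f z) = z"
      by (rule holomorphic_has_inverse[OF hol _ inj]) auto
    have "range k \<subseteq> unit_disk"
    proof safe
      fix w
      obtain z where "z \<in> unit_disk" "w = f z" using U by blast
      then show "k w \<in> unit_disk" using k(2) by simp
    qed
    then have "bounded (range k)" by (rule bounded_subset[OF bounded_ball])
    with k(1) U have "k constant_on UNIV" by (intro Liouville_theorem) simp_all
    then have "k (f 0) = k (f (1 / 2))" by (auto simp: constant_on_def)
    then show False using k(2)[of 0] k(2)[of "1 / 2"] by (simp add: norm_divide)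
  qed
  \<comment> \<open>\<open>infdist\<close> to the empty set is 0, so the lower bound requires a
    frontier point to exist.\<close>
  then have ne: "frontier (f ` unit_disk) \<noteq> {}" by (auto simp: frontier_eq_empty)
  have "1 / 2 \<le> dist (f 0) w" if w: "w \<in> frontier (f ` unit_disk)" for w
  proof (rule ccontr)
    assume "\<not> 1 / 2 \<le> dist (f 0) w"
    then have "norm w < 1 / 2" by (simp add: f0)
    then obtain c where c: "norm w < c" "c < 1 / 2" using dense by blast
    \<comment> \<open>The solution of r / (1 + r) = c, which is below 1 exactly because c <
      1/2.\<close>
    define r where "r = c / (1 - c)"
    have c0: "c > 0" using c(1) norm_ge_zero[of w] by linarith
    have r: "r < 1" using c c0 by (simp add: r_def)
    have small: "norm z \<le> r" if z: "norm z < 1" "norm (f z) < c" for z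
    proof -
      have "norm z / (1 + norm z) < c" using class_C2_growth[OF f z(1)] z(2) by linarith
      moreover have "1 + norm z > 0" by (simp add: add_pos_nonneg)
      ultimately show ?thesis using c by (simp add: r_def field_simps)
    qed
    have "closed (f ` cball 0 r)"
      using hol r by (intro compact_imp_closed compact_continuous_image)
        (auto intro!: holomorphic_on_imp_continuous_on holomorphic_on_subset[OF hol])
    moreover have "w \<notin> f ` cball 0 r"
      using w op r by (auto simp: frontier_def interior_open)
    ultimately have "open (ball 0 c - f ` cball 0 r)" "w \<in> ball 0 c - f ` cball 0 r"
      using c by auto
    moreover have "w \<in> closure (f ` unit_disk)" using w by (simp add: frontier_def)
    ultimately have "(ball 0 c - f ` cball 0 r) \<inter> f ` unit_disk \<noteq> {}"
      using open_Int_closure_eq_empty[of "ball 0 c - f ` cball 0 r" "f ` unit_disk"] by blast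
    then obtain y where y: "y \<in> ball 0 c" "y \<notin> f ` cball 0 r" "y \<in> f ` unit_disk" by blast
    then obtain z where z: "y = f z" "norm z < 1" by auto
    with y(1) have "norm z \<le> r" by (intro small) simp_all
    with y(2) z(1) show False by auto
  qed
  with ne have "1 / 2 \<le> (INF w\<in>frontier (f ` unit_disk). dist (f 0) w)" by (rule cINF_greatest)
  then show ?thesis using ne by (simp add: infdist_def)
qed

section \<open>The majorant of the Bohr sum and the cubic equation\<close>

lemma sums_geometric_from_1:
  fixes r :: real
  assumes "0 \<le> r" "r < 1"
  shows "(\<lambda>n. if n = 0 then 0 else r ^ n) sums (r / (1 - r))"
    and "(\<lambda>n. real n * r ^ n) sums (r / (1 - r)\<^sup>2)"
    and "(\<lambda>n. r ^ (n + 2)) sums (r\<^sup>2 / (1 - r))"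
proof -
  have n: "norm r < 1" using assms by simp
  have "(\<lambda>n. r * r ^ n) sums (r * (1 / (1 - r)))" by (intro sums_mult geometric_sums n)
  then show "(\<lambda>n. if n = 0 then 0 else r ^ n) sums (r / (1 - r))"
    using sums_Suc[of "\<lambda>n. if n = 0 then 0 else r ^ n"] by simp
  have "(\<lambda>n. r * (of_nat (Suc n) * r ^ n)) sums (r * (1 / (1 - r)\<^sup>2))"
    by (intro sums_mult geometric_deriv_sums n)
  then show "(\<lambda>n. real n * r ^ n) sums (r / (1 - r)\<^sup>2)"
    using sums_Suc[of "\<lambda>n. real n * r ^ n"] by (simp add: mult_ac)
  have "(\<lambda>n. r\<^sup>2 * r ^ n) sums (r\<^sup>2 * (1 / (1 - r)))" by (intro sums_mult geometric_sums n)
  then show "(\<lambda>n. r ^ (n + 2)) sums (r\<^sup>2 / (1 - r))" by (simp add: power2_eq_square mult_ac)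
qed

lemma class_C2_bohr_sum_le:
  assumes f: "f \<in> class_C2" and z: "norm z < 1"
  defines "r \<equiv> norm z"
  shows "norm (f z) + norm (deriv f z) * norm z + (\<Sum>n. norm (taylor_coeff f (n + 2) * z ^ (n + 2)))
    \<le> r / (1 - r) + r / (1 - r)\<^sup>2 + r\<^sup>2 / (1 - r)"
proof -
  note hol = class_C2_basic(1,4)[OF f]
  have r: "0 \<le> r" "r < 1" using z by (auto simp: r_def)
  note coeff = class_C2_coeff[OF f]
  have "norm (f z) \<le> r / (1 - r)"
  proof (rule norm_sums_le[OF sums_taylor[OF hol(1) z] sums_geometric_from_1(1)[OF r]])
    fix n
    show "norm (taylor_coeff f n * z ^ n) \<le> (if n = 0 then 0 else r ^ n)"
      using mult_right_mono[OF coeff(2)[of n], of "r ^ n"] r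
      by (simp add: norm_mult norm_power r_def split: if_splits)
  qed
  moreover have "norm (z * deriv f z) \<le> r / (1 - r)\<^sup>2"
  proof (rule norm_sums_le[OF sums_taylor[OF hol(2) z] sums_geometric_from_1(2)[OF r]])
    fix n
    show "norm (taylor_coeff (\<lambda>w. w * deriv f w) n * z ^ n) \<le> real n * r ^ n"
      using mult_right_mono[OF coeff(1)[of n], of "r ^ n"] r
      by (simp add: norm_mult norm_power r_def)
  qed
  moreover have "(\<Sum>n. norm (taylor_coeff f (n + 2) * z ^ (n + 2))) \<le> r\<^sup>2 / (1 - r)"
  proof -
    note s = sums_geometric_from_1(3)[OF r]
    have le: "norm (taylor_coeff f (n + 2) * z ^ (n + 2)) \<le> r ^ (n + 2)" for n
      using mult_right_mono[OF coeff(2)[of "n + 2"], of "r ^ (n + 2)"] r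
      by (simp add: norm_mult norm_power r_def)
    then have "summable (\<lambda>n. norm (taylor_coeff f (n + 2) * z ^ (n + 2)))"
      by (intro summable_comparison_test'[OF sums_summable[OF s], of 0]) auto
    then have "(\<Sum>n. norm (taylor_coeff f (n + 2) * z ^ (n + 2))) \<le> (\<Sum>n. r ^ (n + 2))"
      by (intro suminf_le le sums_summable[OF s])
    then show ?thesis using s by (simp only: sums_iff)
  qed
  ultimately show ?thesis by (simp add: norm_mult mult.commute)
qed

text \<open>Multiplication by 2 (1 - r)^2 produces the cubic. The equivalence serves the inequality
  in one direction and its sharpness in the other.\<close>

lemma bohr_majorant_le_half_iff:
  fixes r :: real
  assumes "r < 1"
  shows "r / (1 - r) + r / (1 - r)\<^sup>2 + r\<^sup>2 / (1 - r) \<le> 1 / 2 \<longleftrightarrow> 0 \<le> 1 - 6 * r + r ^ 2 + 2 * r ^ 3"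
proof -
  have nz: "1 - r \<noteq> 0" and pos: "(1 - r)\<^sup>2 > 0" using assms by auto
  have "r / (1 - r) + r / (1 - r)\<^sup>2 + r\<^sup>2 / (1 - r) = (r * (1 - r) + r + r\<^sup>2 * (1 - r)) / (1 - r)\<^sup>2"
    using nz by (simp add: divide_simps power2_eq_square)
  then show ?thesis using pos
    by (simp add: divide_le_eq power2_eq_square power3_eq_cube algebra_simps)
qed

text \<open>The difference of the values is (y - x) (-6 + (x + y) + 2 (x^2 + x y + y^2)), and the
  second factor is negative for arguments up to 1/5.\<close>

lemma r21_cubic_decreasing:
  fixes x y :: real
  assumes "0 \<le> x" "x < y" "y \<le> 1 / 5"
  shows "1 - 6 * y + y ^ 2 + 2 * y ^ 3 < 1 - 6 * x + x ^ 2 + 2 * x ^ 3"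
proof -
  have "x * y \<le> (1 / 5) * (1 / 5)" "x * x \<le> (1 / 5) * (1 / 5)" "y * y \<le> (1 / 5) * (1 / 5)"
    using assms by (intro mult_mono; simp)+
  moreover define q where "q = x * x + x * y + y * y"
  ultimately have "q \<le> 3 / 25" by simp
  then have "- 6 + (x + y) + 2 * q < 0" using assms by linarith
  then have "(y - x) * (- 6 + (x + y) + 2 * q) < 0"
    using assms by (simp add: mult_pos_neg)
  then show ?thesis by (simp add: q_def power2_eq_square power3_eq_cube algebra_simps)
qed

text \<open>From x^3 <= x^2 follows 1 - 6 x + 3 x^2 >= 0. Then x^2 <= x gives x <= 1/3, and the
  better estimate x^2 <= x / 3 gives 1 - 5 x >= 0.\<close>

lemma r21_cubic_nonneg_imp_le:
  fixes x :: real
  assumes "0 \<le> x" "x < 1" "1 - 6 * x + x ^ 2 + 2 * x ^ 3 \<ge> 0"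
  shows "x \<le> 1 / 5"
proof -
  have "x ^ 3 \<le> x ^ 2" using assms by (intro power_decreasing) auto
  then have *: "1 - 6 * x + 3 * (x * x) \<ge> 0" using assms by (simp add: power2_eq_square)
  have "x * x \<le> 1 * x" using assms by (intro mult_right_mono) auto
  with * have "x \<le> 1 / 3" by simp
  then have "x * x \<le> (1 / 3) * x" using assms by (intro mult_right_mono) auto
  with * show ?thesis by simp
qed

lemma is_r21_unique: "is_r21 x \<Longrightarrow> is_r21 y \<Longrightarrow> x = y"
  using r21_cubic_nonneg_imp_le[of x] r21_cubic_nonneg_imp_le[of y]
    r21_cubic_decreasing[of x y] r21_cubic_decreasing[of y x]
  by (cases x y rule: linorder_cases) (auto simp: is_r21_def)

lemma is_r21_exists: "\<exists>r. is_r21 r \<and> \<bar>r - 0.173417\<bar> \<le> 0.0000005"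
proof -
  \<comment> \<open>The endpoints lie half a unit of the sixth decimal on either side of 0.173417,
    and the cubic changes sign between them.\<close>
  have "\<exists>r::real\<ge>0.1734165. r \<le> 0.1734175 \<and> 1 - 6 * r + r ^ 2 + 2 * r ^ 3 = 0"
    by (rule IVT2') (auto simp: power2_eq_square power3_eq_cube intro!: continuous_intros)
  then obtain r :: real where "0.1734165 \<le> r" "r \<le> 0.1734175" "1 - 6 * r + r ^ 2 + 2 * r ^ 3 = 0" by blast
  moreover from this have "\<bar>r - 0.173417\<bar> \<le> 0.0000005" by (intro abs_leI) (simp_all add: field_simps)
  ultimately show ?thesis by (intro exI[of _ r] conjI) (simp_all add: is_r21_def)
qed

lemma is_r21_r21: "is_r21 r21"
  unfolding r21_def using is_r21_exists is_r21_unique by (metis theI')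

lemma r21_cubic_nonneg_iff:
  assumes "0 \<le> r" "r < 1"
  shows "0 \<le> 1 - 6 * r + r ^ 2 + 2 * r ^ 3 \<longleftrightarrow> r \<le> r21"
  using r21_cubic_nonneg_imp_le[of r] r21_cubic_nonneg_imp_le[of r21]
    r21_cubic_decreasing[of r r21] r21_cubic_decreasing[of r21 r] is_r21_r21 assms
  by (cases r r21 rule: linorder_cases) (auto simp: is_r21_def)

subsection \<open>The extremal function\<close>

definition extremal_fun :: "complex \<Rightarrow> complex"
  where "extremal_fun z = z / (1 - z)"

lemma extremal_fun_deriv:
  assumes "norm z < 1"
  shows "deriv extremal_fun z = 1 / (1 - z)\<^sup>2"
proof -
  have "1 - z \<noteq> 0" using assms by auto
  then have "(extremal_fun has_field_derivative 1 / (1 - z)\<^sup>2) (at z)"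
    unfolding extremal_fun_def[abs_def]
    by (auto intro!: derivative_eq_intros simp: power2_eq_square)
  then show ?thesis by (rule DERIV_imp_deriv)
qed

lemma extremal_fun_props:
  shows "extremal_fun holomorphic_on unit_disk" "inj_on extremal_fun unit_disk"
    and "extremal_fun ` unit_disk = {w. Re w > - (1 / 2)}"
proof -
  \<comment> \<open>z / (1 - z) is the half-plane map for c = 1/2, translated by -1/2.\<close>
  define F where "F = (\<lambda>z::complex. (1 / 2 + cnj (1 / 2) * z) / (1 - z))"
  note F = halfplane_map[of "1 / 2", folded F_def]
  have eq: "extremal_fun z = F z - 1 / 2" if "z \<in> unit_disk" for z
  proof -
    have "1 - z \<noteq> 0" using that by auto
    then show ?thesis by (simp add: extremal_fun_def F_def field_simps)
  qed
  show "extremal_fun holomorphic_on unit_disk"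
    unfolding extremal_fun_def[abs_def] by (intro holomorphic_intros) auto
  show "inj_on extremal_fun unit_disk"
    using F(2) by (simp add: inj_on_def eq)
  have "extremal_fun ` unit_disk = (\<lambda>w. w - 1 / 2) ` F ` unit_disk"
    unfolding image_image by (rule image_cong) (simp_all add: eq)
  also have "\<dots> = (\<lambda>w. w - 1 / 2) ` {w. Re w > 0}" using F(3) by simp
  also have "\<dots> = {w. Re w > - (1 / 2)}"
  proof safe
    fix w :: complex assume "Re w > - (1 / 2)"
    then show "w \<in> (\<lambda>w. w - 1 / 2) ` {w. Re w > 0}" by (intro image_eqI[of _ _ "w + 1 / 2"]) auto
  qed auto
  finally show "extremal_fun ` unit_disk = {w. Re w > - (1 / 2)}" .
qed

text \<open>The function serves as its own g: the quotient is then (1 + z) / (1 - z), the half-plane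
  map for c = 1.\<close>

lemma extremal_fun_class_C2: "extremal_fun \<in> class_C2"
proof -
  have "convex_function extremal_fun"
    unfolding convex_function_def extremal_fun_props(3)
    using extremal_fun_props by (simp add: convex_halfspace_Re_gt)
  moreover have "Re (deriv (\<lambda>w. w * deriv extremal_fun w) z / deriv extremal_fun z) > 0"
    if z: "z \<in> unit_disk" for z
  proof -
    have nz: "1 - z \<noteq> 0" using z by auto
    have "\<forall>\<^sub>F w in nhds z. w * deriv extremal_fun w = w / (1 - w)\<^sup>2"
      using eventually_nhds_in_open[of unit_disk z] z
      by (auto elim!: eventually_mono simp: extremal_fun_deriv)
    then have "deriv (\<lambda>w. w * deriv extremal_fun w) z = deriv (\<lambda>w. w / (1 - w)\<^sup>2) z"
      by (rule deriv_cong_ev) simp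
    also have "deriv (\<lambda>w. w / (1 - w)\<^sup>2) z = (1 + z) / (1 - z) ^ 3"
    proof -
      have "((\<lambda>w. w / (1 - w)\<^sup>2) has_field_derivative
          (1 * (1 - z)\<^sup>2 - z * (2 * (1 - z) * (0 - 1))) / ((1 - z)\<^sup>2 * (1 - z)\<^sup>2)) (at z)"
        using nz by (auto intro!: derivative_eq_intros)
      moreover have "1 * (1 - z)\<^sup>2 - z * (2 * (1 - z) * (0 - 1)) = (1 - z) * (1 + z)"
        "(1 - z)\<^sup>2 * (1 - z)\<^sup>2 = (1 - z) * (1 - z) ^ 3"
        by (simp_all add: power2_eq_square power3_eq_cube algebra_simps)
      ultimately show ?thesis
        by (simp only: mult_divide_mult_cancel_left[OF nz] DERIV_imp_deriv)
    qed
    finally have "deriv (\<lambda>w. w * deriv extremal_fun w) z / deriv extremal_fun z =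
        (1 + cnj 1 * z) / (1 - z)"
      using z nz by (simp add: extremal_fun_deriv power2_eq_square power3_eq_cube)
    moreover have "(\<lambda>z. (1 + cnj 1 * z) / (1 - z)) ` unit_disk = {w. Re w > 0}"
      by (rule halfplane_map(3)) simp
    then have "(1 + cnj 1 * z) / (1 - z) \<in> {w. Re w > 0}" using z by blast
    ultimately show ?thesis by simp
  qed
  ultimately show ?thesis
    unfolding class_C2_def using extremal_fun_props(1)
    by (auto simp: extremal_fun_deriv extremal_fun_def intro!: exI[of _ extremal_fun])
qed

lemma taylor_coeff_extremal_fun: "taylor_coeff extremal_fun (Suc n) = 1"
proof -
  have "extremal_fun has_fps_expansion Abs_fps (\<lambda>n. if n = 0 then 0 else 1)"
  proof (rule has_fps_expansionI)
    have "eventually (\<lambda>u. u \<in> unit_disk) (nhds (0::complex))"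
      by (intro eventually_nhds_in_open) auto
    then show "\<forall>\<^sub>F u in nhds 0. (\<lambda>n. fps_nth (Abs_fps (\<lambda>n. if n = 0 then 0 else 1)) n * u ^ n) sums extremal_fun u"
    proof eventually_elim
      case (elim u)
      then have "(\<lambda>n. u * u ^ n) sums (u * (1 / (1 - u)))" by (intro sums_mult geometric_sums) simp
      then show ?case
        using sums_Suc[of "\<lambda>n. (if n = 0 then 0 else 1) * u ^ n"] by (simp add: extremal_fun_def)
    qed
  qed
  from taylor_coeff_eqI[OF this] show ?thesis by simp
qed

text \<open>At a point r of [0, 1) all three estimates of the majorant are equalities. The frontier
  point -1/2 gives the upper bound on the distance.\<close>

lemma bohr_inequality_extremal_funD:
  assumes r: "0 \<le> r" "r < 1" and B: "bohr_inequality extremal_fun (of_real r)"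
  shows "r / (1 - r) + r / (1 - r)\<^sup>2 + r\<^sup>2 / (1 - r) \<le> 1 / 2"
proof -
  have n: "norm (1 - complex_of_real r) = 1 - r"
    using norm_of_real[of "1 - r", where 'a = complex] r by simp
  have "norm (extremal_fun (of_real r)) = r / (1 - r)"
    using r n by (simp add: extremal_fun_def norm_divide)
  moreover have "norm (deriv extremal_fun (of_real r)) * norm (complex_of_real r) = r / (1 - r)\<^sup>2"
    using r n by (simp add: extremal_fun_deriv norm_divide norm_power)
  moreover have "(\<Sum>n. norm (taylor_coeff extremal_fun (n + 2) * of_real r ^ (n + 2))) = r\<^sup>2 / (1 - r)"
    using sums_geometric_from_1(3)[OF r] r
    by (simp add: taylor_coeff_extremal_fun norm_mult norm_power sums_iff)
  moreover have "infdist (extremal_fun 0) (frontier (extremal_fun ` unit_disk)) \<le> 1 / 2"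
  proof -
    have "frontier {w. Re w > - (1 / 2)} = {w. Re w = - (1 / 2)}"
      using frontier_halfspace_gt[of "1::complex" "- (1 / 2)"] by (simp add: inner_complex_def)
    then have "- (1 / 2) \<in> frontier (extremal_fun ` unit_disk)"
      by (simp add: extremal_fun_props(3))
    from infdist_le[OF this, of "extremal_fun 0"] show ?thesis
      by (simp add: extremal_fun_def norm_divide)
  qed
  ultimately show ?thesis using B unfolding bohr_inequality_def by linarith
qed

theorem theorem3p2:
  shows "(\<exists>!r. is_r21 r) \<and> \<bar>r21 - 0.173417\<bar> \<le> 0.0000005 \<and>
    (\<forall>f\<in>class_C2. \<forall>z. norm z \<le> r21 \<longrightarrow> bohr_inequality f z) \<and>
    (\<forall>R>r21. \<not> (\<forall>f\<in>class_C2. \<forall>z\<in>unit_disk. norm z \<le> R \<longrightarrow> bohr_inequality f z))"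
proof (intro conjI ballI allI impI)
  show "\<exists>!r. is_r21 r" using is_r21_r21 is_r21_unique by blast
  show "\<bar>r21 - 0.173417\<bar> \<le> 0.0000005"
    using is_r21_exists is_r21_unique[OF is_r21_r21] by blast
  have r21: "0 < r21" "r21 < 1" using is_r21_r21 by (auto simp: is_r21_def)
  show "bohr_inequality f z" if f: "f \<in> class_C2" and z: "norm z \<le> r21" for f z
  proof -
    have z1: "norm z < 1" using z r21 by simp
    have "norm z / (1 - norm z) + norm z / (1 - norm z)\<^sup>2 + (norm z)\<^sup>2 / (1 - norm z) \<le> 1 / 2"
      using bohr_majorant_le_half_iff[OF z1] r21_cubic_nonneg_iff[OF _ z1] z by simp
    with class_C2_bohr_sum_le[OF f z1] class_C2_infdist_frontier[OF f]
    show ?thesis unfolding bohr_inequality_def by linarith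
  qed
  show "\<not> (\<forall>f\<in>class_C2. \<forall>z\<in>unit_disk. norm z \<le> R \<longrightarrow> bohr_inequality f z)" if R: "R > r21" for R
  proof
    assume all: "\<forall>f\<in>class_C2. \<forall>z\<in>unit_disk. norm z \<le> R \<longrightarrow> bohr_inequality f z"
    \<comment> \<open>R may exceed 1, so the counterexample is taken at a radius strictly between
      \<open>r21\<close> and 1.\<close>
    define r where "r = min R ((1 + r21) / 2)"
    have r: "0 \<le> r" "r < 1" "r \<le> R" "r21 < r" using R r21 by (auto simp: r_def min_def)
    have "bohr_inequality extremal_fun (of_real r)"
      using all extremal_fun_class_C2 r by auto
    from bohr_inequality_extremal_funD[OF r(1,2) this]
    show False
      using bohr_majorant_le_half_iff[OF r(2)] r21_cubic_nonneg_iff[OF r(1,2)] r(4) by simp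
  qed
qed

end
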